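(* For $c\in(0,1)$, $\beta>0$ and $n\in\mathbb{N}$, let $$\gamma_n(c,\beta)=\sup\{\|\Delta f\|_{c,\beta} : f\in\mathcal{P}_n,\ \|f\|_{c,\beta}=1\}$$ be the best (smallest possible) constant $\gamma_n$ in the inequality $\|\Delta p\|_{c,\beta}\le \gamma_n\,\|p\|_{c,\beta}$, $p\in\mathcal{P}_n$. Then: (i) For every $c\in(0,1)$ and every $n\in\mathbb{N}$, $$\gamma_n(c,1)<1+\frac{1}{\sqrt{c}}.$$ Moreover, $$\lim_{n\to\infty}\gamma_n(c,1)=1+\frac{1}{\sqrt{c}}.$$ (ii) For every fixed $n\in\mathbb{N}$ and $c\in(0,1)$, $\gamma_n(c,\beta)$ is a decreasing function of $\beta\in(0,\infty)$. (iii) For every fixed $c\in(0,1)$ and $\beta>0$ there exists a constant $C(c,\beta)>0$ such that $\gamma_n(c,\beta)\le C(c,\beta)$ for every $n\in\mathbb{N}$.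
   Context: $\mathbb{N}=\{1,2,\ldots\}$ and $\mathbb{N}_0=\mathbb{N}\cup\{0\}$. $\mathcal{P}_n$ is the set of real algebraic polynomials of degree at most $n$. The forward difference operator is $\Delta f(x):=f(x+1)-f(x)$. For $c\in(0,1)$ and $\beta>0$, the Meixner norm is $$\|f\|_{c,\beta}=\Big(\sum_{k=0}^{\infty}\frac{(\beta)_k}{k!}\,c^k\,[f(k)]^2\Big)^{1/2},$$ where $(\beta)_k=\beta(\beta+1)\cdots(\beta+k-1)$ for $k\in\mathbb{N}$ and $(\beta)_0=1$. *)

theory Defs
  imports "HOL-Analysis.Analysis" "HOL-Computational_Algebra.Polynomial"
begin

definition poly_space :: "nat \<Rightarrow> (real \<Rightarrow> real) set" where
  "poly_space n = {poly p | p. degree p \<le> n}"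

definition fwd_diff :: "(real \<Rightarrow> real) \<Rightarrow> real \<Rightarrow> real" where
  "fwd_diff f = (\<lambda>x. f (x + 1) - f x)"

definition meixner_norm :: "real \<Rightarrow> real \<Rightarrow> (real \<Rightarrow> real) \<Rightarrow> real" where
  "meixner_norm c \<beta> f = sqrt (\<Sum>k. pochhammer \<beta> k / fact k * c ^ k * (f (real k))\<^sup>2)"

definition markov_const :: "nat \<Rightarrow> real \<Rightarrow> real \<Rightarrow> real" where
  "markov_const n c \<beta> =
     Sup {meixner_norm c \<beta> (fwd_diff f) | f. f \<in> poly_space n \<and> meixner_norm c \<beta> f = 1}"

text \<open>
  Series and suprema of reals are total functions in HOL, with unspecified values when they do
  not exist. The lemmas below show that, for \<open>0 < c < 1\<close> and \<open>0 < \<beta>\<close>, the series defining the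
  norm of a polynomial converges, the supremum is over a nonempty set that is bounded above, and
  the supremum is the least constant in the Markov inequality.
\<close>

context
  fixes c \<beta> :: real
  assumes c: "0 < c" "c < 1" and \<beta>: "0 < \<beta>"
begin

abbreviation (input) "meixner_wt k \<equiv> pochhammer \<beta> k / fact k * c ^ k"

lemma meixner_weight_pos: "meixner_wt k > 0"
  using c \<beta> by (simp add: pochhammer_pos)

lemma meixner_term_nonneg: "0 \<le> meixner_wt k * (x :: real)\<^sup>2"
  by (rule mult_nonneg_nonneg[OF less_imp_le[OF meixner_weight_pos] zero_le_power2])

lemma meixner_summable_monom: "summable (\<lambda>k. meixner_wt k * real k ^ m)"
proof -
  have "(\<lambda>k. 1 + (\<beta> - 1) * inverse (real (Suc k))) \<longlonglongrightarrow> 1 + (\<beta> - 1) * 0"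
    by (intro tendsto_intros LIMSEQ_inverse_real_of_nat)
  moreover have "(\<lambda>k. 1 + (\<beta> - 1) * inverse (real (Suc k))) = (\<lambda>k. (\<beta> + real k) / (1 + real k))"
    by (auto simp: field_simps)
  ultimately have "(\<lambda>k. (\<beta> + real k) / (1 + real k)) \<longlonglongrightarrow> 1" by simp
  moreover have "(\<lambda>k. (1 + 1 / real k) ^ m) \<longlonglongrightarrow> (1 + 0) ^ m"
    by (intro tendsto_power tendsto_add tendsto_const lim_1_over_n)
  ultimately have "(\<lambda>k. c * ((\<beta> + real k) / (1 + real k)) * (1 + 1 / real k) ^ m) \<longlonglongrightarrow> c * 1 * (1 + 0) ^ m"
    by (intro tendsto_mult tendsto_const)
  hence "(\<lambda>k. c * ((\<beta> + real k) / (1 + real k)) * (1 + 1 / real k) ^ m) \<longlonglongrightarrow> c" by simp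
  moreover have "c < (1 + c) / 2" using c by simp
  ultimately have "\<forall>\<^sub>F k in sequentially.
      c * ((\<beta> + real k) / (1 + real k)) * (1 + 1 / real k) ^ m < (1 + c) / 2"
    by (rule order_tendstoD(2))
  then obtain N where N: "\<And>k. k \<ge> N \<Longrightarrow>
      c * ((\<beta> + real k) / (1 + real k)) * (1 + 1 / real k) ^ m < (1 + c) / 2"
    by (auto simp: eventually_sequentially)
  show ?thesis
  proof (rule summable_ratio_test[where c = "(1 + c) / 2" and N = "max N 1"])
    show "(1 + c) / 2 < 1" using c by simp
    fix k assume k: "max N 1 \<le> k"
    have nonneg: "meixner_wt k * real k ^ m \<ge> 0" for k
      by (rule mult_nonneg_nonneg[OF less_imp_le[OF meixner_weight_pos]]) simp
    have "real (Suc k) = (1 + 1 / real k) * real k" using k by (simp add: field_simps)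
    hence "real (Suc k) ^ m = (1 + 1 / real k) ^ m * real k ^ m"
      by (metis power_mult_distrib)
    moreover have "meixner_wt (Suc k) = c * ((\<beta> + real k) / (1 + real k)) * meixner_wt k"
      by (simp add: pochhammer_rec' field_simps)
    ultimately have "meixner_wt (Suc k) * real (Suc k) ^ m =
        (c * ((\<beta> + real k) / (1 + real k)) * (1 + 1 / real k) ^ m) * (meixner_wt k * real k ^ m)"
      by (simp only: ac_simps)
    also have "\<dots> \<le> (1 + c) / 2 * (meixner_wt k * real k ^ m)"
      using N[of k] k nonneg by (intro mult_right_mono) auto
    finally show "norm (meixner_wt (Suc k) * real (Suc k) ^ m) \<le> (1 + c) / 2 * norm (meixner_wt k * real k ^ m)"
      using nonneg[of k] nonneg[of "Suc k"] by (simp only: real_norm_def abs_of_nonneg)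
  qed
qed

lemma meixner_summable_poly: "summable (\<lambda>k. meixner_wt k * poly q (real k))"
proof -
  have "summable (\<lambda>k. \<Sum>i\<le>degree q. coeff q i * (meixner_wt k * real k ^ i))"
    by (intro summable_sum summable_mult meixner_summable_monom)
  thus ?thesis by (simp add: poly_altdef sum_distrib_left mult_ac)
qed

lemma meixner_summable:
  assumes "f \<in> poly_space n"
  shows "summable (\<lambda>k. meixner_wt k * (f (real k))\<^sup>2)"
proof -
  obtain p where "f = poly p" using assms by (auto simp: poly_space_def)
  thus ?thesis using meixner_summable_poly[of "p\<^sup>2"] by simp
qed

lemma fwd_diff_poly_space:
  assumes "f \<in> poly_space n"
  shows "fwd_diff f \<in> poly_space n"
proof -
  obtain p where p: "f = poly p" "degree p \<le> n" using assms by (auto simp: poly_space_def)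
  have "fwd_diff f = poly (p \<circ>\<^sub>p [:1, 1:] - p)"
    by (auto simp: fwd_diff_def p poly_pcompose add_ac)
  moreover have "degree (p \<circ>\<^sub>p [:1, 1:] - p) \<le> n"
    using p by (intro degree_diff_le) (simp_all add: degree_pcompose)
  ultimately show ?thesis unfolding poly_space_def by blast
qed

lemma meixner_norm_sq:
  assumes "f \<in> poly_space n"
  shows "(meixner_norm c \<beta> f)\<^sup>2 = (\<Sum>k. meixner_wt k * (f (real k))\<^sup>2)"
  unfolding meixner_norm_def
  by (intro real_sqrt_pow2 suminf_nonneg meixner_summable[OF assms] meixner_term_nonneg)

lemma meixner_norm_nonneg:
  assumes "f \<in> poly_space n"
  shows "meixner_norm c \<beta> f \<ge> 0"
  unfolding meixner_norm_def
  by (intro real_sqrt_ge_zero suminf_nonneg meixner_summable[OF assms] meixner_term_nonneg)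

lemma meixner_norm_value:
  assumes "f \<in> poly_space n"
  shows "(f (real i))\<^sup>2 \<le> (meixner_norm c \<beta> f)\<^sup>2 / meixner_wt i"
proof -
  have "(\<Sum>k\<in>{i}. meixner_wt k * (f (real k))\<^sup>2) \<le> (\<Sum>k. meixner_wt k * (f (real k))\<^sup>2)"
    by (intro sum_le_suminf meixner_summable[OF assms] meixner_term_nonneg) simp
  hence "meixner_wt i * (f (real i))\<^sup>2 \<le> (meixner_norm c \<beta> f)\<^sup>2"
    using meixner_norm_sq[OF assms] by simp
  thus ?thesis
    by (subst pos_le_divide_eq[OF meixner_weight_pos]) (simp only: mult.commute)
qed

lemma poly_space_scale:
  assumes "f \<in> poly_space n"
  shows "(\<lambda>x. a * f x) \<in> poly_space n"
proof -
  obtain p where p: "f = poly p" "degree p \<le> n" using assms by (auto simp: poly_space_def)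
  have "(\<lambda>x. a * f x) = poly (smult a p)" "degree (smult a p) \<le> n"
    using p by auto
  thus ?thesis unfolding poly_space_def by blast
qed

lemma meixner_norm_scale:
  assumes "f \<in> poly_space n"
  shows "meixner_norm c \<beta> (\<lambda>x. a * f x) = \<bar>a\<bar> * meixner_norm c \<beta> f"
proof -
  have "(\<Sum>k. meixner_wt k * (a * f (real k))\<^sup>2) = (\<Sum>k. a\<^sup>2 * (meixner_wt k * (f (real k))\<^sup>2))"
    by (simp add: power_mult_distrib mult_ac)
  also have "\<dots> = a\<^sup>2 * (\<Sum>k. meixner_wt k * (f (real k))\<^sup>2)"
    by (intro suminf_mult meixner_summable[OF assms])
  finally show ?thesis by (simp add: meixner_norm_def real_sqrt_mult)
qed

lemma lagrange_interpolation:
  obtains L :: "nat \<Rightarrow> real poly" where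
    "\<And>i. i \<le> n \<Longrightarrow> degree (L i) \<le> n"
    "\<And>p x. degree p \<le> n \<Longrightarrow> poly p x = (\<Sum>i\<le>n. poly p (real i) * poly (L i) x)"
proof -
  define L where "L i = (\<Prod>j\<in>{..n}-{i}. smult (1 / (real i - real j)) [:- real j, 1:])" for i
  have deg: "degree (L i) \<le> n" if "i \<le> n" for i
  proof -
    have "degree (L i) \<le> (\<Sum>j\<in>{..n}-{i}. degree (smult (1 / (real i - real j)) [:- real j, 1:]))"
      unfolding L_def by (rule degree_prod_sum_le[unfolded comp_def]) simp
    also have "\<dots> \<le> (\<Sum>j\<in>{..n}-{i}. 1)" by (intro sum_mono) simp
    also have "\<dots> = n" using that by simp
    finally show ?thesis .
  qed
  have val: "poly (L i) (real k) = (if k = i then 1 else 0)" if "k \<le> n" for i k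
    using that by (auto simp: L_def poly_prod diff_divide_distrib[symmetric] intro!: prod.neutral)
  have "poly p x = (\<Sum>i\<le>n. poly p (real i) * poly (L i) x)" if p: "degree p \<le> n" for p x
  proof -
    define q where "q = (\<Sum>i\<le>n. smult (poly p (real i)) (L i))"
    have "degree q \<le> n"
      unfolding q_def using deg by (intro degree_sum_le) auto
    moreover have "poly p y = poly q y" if y: "y \<in> real ` {..n}" for y
    proof -
      obtain k where k: "y = real k" "k \<le> n" using y by auto
      have "poly q y = (\<Sum>i\<le>n. if k = i then poly p (real i) else 0)"
        unfolding q_def poly_sum using k val by (intro sum.cong) auto
      thus ?thesis using k by simp
    qed
    ultimately have "p = q" using p
      by (intro poly_eqI_degree[where A = "real ` {..n}"]) (auto simp: card_image)
    hence "poly p x = poly q x" by simp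
    thus ?thesis by (simp add: q_def poly_sum)
  qed
  with deg that show thesis by blast
qed

lemma markov_bound:
  obtains K where "\<And>f. f \<in> poly_space n \<Longrightarrow>
    meixner_norm c \<beta> (fwd_diff f) \<le> K * meixner_norm c \<beta> f"
proof -
  obtain L :: "nat \<Rightarrow> real poly" where
    deg: "\<And>i. i \<le> n \<Longrightarrow> degree (L i) \<le> n" and
    lag: "\<And>p x. degree p \<le> n \<Longrightarrow> poly p x = (\<Sum>i\<le>n. poly p (real i) * poly (L i) x)"
    using lagrange_interpolation[of n] by blast
  define D where "D i = fwd_diff (poly (L i))" for i
  have D: "D i \<in> poly_space n" if "i \<le> n" for i
    using deg[OF that] unfolding D_def
    by (intro fwd_diff_poly_space) (auto simp: poly_space_def)
  define K where "K = real (Suc n) * (\<Sum>i\<le>n. (meixner_norm c \<beta> (D i))\<^sup>2 / meixner_wt i)"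
  have K: "K \<ge> 0" unfolding K_def using meixner_weight_pos
    by (intro mult_nonneg_nonneg sum_nonneg divide_nonneg_pos) auto
  have main: "(meixner_norm c \<beta> (fwd_diff f))\<^sup>2 \<le> K * (meixner_norm c \<beta> f)\<^sup>2"
    if f: "f \<in> poly_space n" for f
  proof -
    have lf: "f x = (\<Sum>i\<le>n. f (real i) * poly (L i) x)" for x
      using lag f by (auto simp: poly_space_def)
    have df: "fwd_diff f x = (\<Sum>i\<le>n. f (real i) * D i x)" for x
      unfolding fwd_diff_def D_def
      by (subst (1 2) lf) (simp add: sum_subtractf right_diff_distrib)
    have summ: "summable (\<lambda>k. (f (real i))\<^sup>2 * (meixner_wt k * (D i (real k))\<^sup>2))" if "i \<le> n" for i
      by (rule summable_mult[OF meixner_summable[OF D[OF that]]])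
    have "(meixner_norm c \<beta> (fwd_diff f))\<^sup>2 = (\<Sum>k. meixner_wt k * (fwd_diff f (real k))\<^sup>2)"
      by (rule meixner_norm_sq[OF fwd_diff_poly_space[OF f]])
    also have "\<dots> \<le> (\<Sum>k. real (Suc n) * (\<Sum>i\<le>n. (f (real i))\<^sup>2 * (meixner_wt k * (D i (real k))\<^sup>2)))"
    proof (rule suminf_le)
      fix k
      have "(fwd_diff f (real k))\<^sup>2 \<le> real (Suc n) * (\<Sum>i\<le>n. (f (real i) * D i (real k))\<^sup>2)"
        unfolding df using sum_squared_le_sum_of_squares[of "\<lambda>i. f (real i) * D i (real k)" "{..n}"] by (simp add: mult.commute)
      hence "meixner_wt k * (fwd_diff f (real k))\<^sup>2 \<le> meixner_wt k * (real (Suc n) * (\<Sum>i\<le>n. (f (real i) * D i (real k))\<^sup>2))"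
        using meixner_weight_pos[of k] by (intro mult_left_mono) auto
      thus "meixner_wt k * (fwd_diff f (real k))\<^sup>2 \<le>
          real (Suc n) * (\<Sum>i\<le>n. (f (real i))\<^sup>2 * (meixner_wt k * (D i (real k))\<^sup>2))"
        by (simp add: sum_distrib_left power_mult_distrib mult_ac)
    next
      show "summable (\<lambda>k. meixner_wt k * (fwd_diff f (real k))\<^sup>2)"
        by (rule meixner_summable[OF fwd_diff_poly_space[OF f]])
      show "summable (\<lambda>k. real (Suc n) * (\<Sum>i\<le>n. (f (real i))\<^sup>2 * (meixner_wt k * (D i (real k))\<^sup>2)))"
        by (intro summable_mult[OF summable_sum] summ) simp
    qed
    also have "\<dots> = real (Suc n) * (\<Sum>k. \<Sum>i\<le>n. (f (real i))\<^sup>2 * (meixner_wt k * (D i (real k))\<^sup>2))"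
      by (intro suminf_mult[OF summable_sum] summ) simp
    also have "(\<Sum>k. \<Sum>i\<le>n. (f (real i))\<^sup>2 * (meixner_wt k * (D i (real k))\<^sup>2)) =
        (\<Sum>i\<le>n. \<Sum>k. (f (real i))\<^sup>2 * (meixner_wt k * (D i (real k))\<^sup>2))"
      by (intro suminf_sum summ) simp
    also have "\<dots> = (\<Sum>i\<le>n. (f (real i))\<^sup>2 * (meixner_norm c \<beta> (D i))\<^sup>2)"
      by (intro sum.cong refl) (simp only: meixner_norm_sq[OF D] suminf_mult[OF meixner_summable[OF D]] atMost_iff)
    also have "\<dots> \<le> (\<Sum>i\<le>n. ((meixner_norm c \<beta> f)\<^sup>2 / meixner_wt i) * (meixner_norm c \<beta> (D i))\<^sup>2)"
      by (intro sum_mono mult_right_mono meixner_norm_value[OF f]) auto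
    also have "\<dots> = (\<Sum>i\<le>n. (meixner_norm c \<beta> (D i))\<^sup>2 / meixner_wt i) * (meixner_norm c \<beta> f)\<^sup>2"
      by (subst sum_distrib_right) (simp add: mult_ac)
    finally show ?thesis by (simp add: K_def mult_ac)
  qed
  show thesis
  proof (rule that[of "sqrt K"])
    fix f assume f: "f \<in> poly_space n"
    have "sqrt ((meixner_norm c \<beta> (fwd_diff f))\<^sup>2) \<le> sqrt (K * (meixner_norm c \<beta> f)\<^sup>2)"
      using main[OF f] by (rule real_sqrt_le_mono)
    thus "meixner_norm c \<beta> (fwd_diff f) \<le> sqrt K * meixner_norm c \<beta> f"
      using meixner_norm_nonneg[OF f] meixner_norm_nonneg[OF fwd_diff_poly_space[OF f]]
      by (simp add: real_sqrt_mult)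
  qed
qed

lemma markov_set_bdd_above:
  "bdd_above {meixner_norm c \<beta> (fwd_diff f) | f. f \<in> poly_space n \<and> meixner_norm c \<beta> f = 1}"
proof -
  obtain K where K: "\<And>f. f \<in> poly_space n \<Longrightarrow>
    meixner_norm c \<beta> (fwd_diff f) \<le> K * meixner_norm c \<beta> f"
    using markov_bound[of n] by blast
  show ?thesis
    using K by (intro bdd_aboveI[where M = K]) fastforce
qed

lemma markov_set_nonempty:
  "{meixner_norm c \<beta> (fwd_diff f) | f. f \<in> poly_space n \<and> meixner_norm c \<beta> f = 1} \<noteq> {}"
proof -
  have "(\<lambda>_. 1) = poly [:1::real:]" by auto
  hence f: "(\<lambda>_. 1) \<in> poly_space n"
    unfolding poly_space_def by (intro CollectI exI[of _ "[:1:]"]) auto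
  define r where "r = meixner_norm c \<beta> (\<lambda>_. 1)"
  have "r \<noteq> 0" using meixner_norm_value[OF f, of 0] by (auto simp: r_def)
  moreover have "r \<ge> 0" using meixner_norm_nonneg[OF f] by (simp add: r_def)
  ultimately have "meixner_norm c \<beta> (\<lambda>x. (1 / r) * 1) = 1"
    using meixner_norm_scale[OF f, of "1 / r"] by (simp add: r_def)
  with poly_space_scale[OF f, of "1 / r"] show ?thesis by blast
qed

lemma markov_inequality:
  assumes f: "f \<in> poly_space n"
  shows "meixner_norm c \<beta> (fwd_diff f) \<le> markov_const n c \<beta> * meixner_norm c \<beta> f"
proof (cases "meixner_norm c \<beta> f = 0")
  case True
  obtain K where "\<And>f. f \<in> poly_space n \<Longrightarrow>
    meixner_norm c \<beta> (fwd_diff f) \<le> K * meixner_norm c \<beta> f"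
    using markov_bound[of n] by blast
  from this[OF f] True show ?thesis by simp
next
  case False
  define r where "r = meixner_norm c \<beta> f"
  have r: "r > 0" using False meixner_norm_nonneg[OF f] by (simp add: r_def)
  let ?g = "\<lambda>x. (1 / r) * f x"
  have "meixner_norm c \<beta> ?g = 1"
    using r meixner_norm_scale[OF f, of "1 / r"] by (simp add: r_def)
  hence "meixner_norm c \<beta> (fwd_diff ?g) \<le> markov_const n c \<beta>"
    unfolding markov_const_def using poly_space_scale[OF f, of "1 / r"]
    by (intro cSup_upper markov_set_bdd_above) blast
  moreover have "fwd_diff ?g = (\<lambda>x. (1 / r) * fwd_diff f x)"
    by (auto simp: fwd_diff_def right_diff_distrib diff_divide_distrib)
  ultimately have "(1 / r) * meixner_norm c \<beta> (fwd_diff f) \<le> markov_const n c \<beta>"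
    using r meixner_norm_scale[OF fwd_diff_poly_space[OF f], of "1 / r"] by simp
  thus ?thesis using r by (simp add: r_def[symmetric] field_simps)
qed

lemma markov_const_least:
  assumes "\<And>f. f \<in> poly_space n \<Longrightarrow> meixner_norm c \<beta> (fwd_diff f) \<le> g * meixner_norm c \<beta> f"
  shows "markov_const n c \<beta> \<le> g"
  unfolding markov_const_def using assms
  by (intro cSup_least markov_set_nonempty) fastforce

end

end

theory Submission
  imports Defs
begin

text \<open>
  Put \<open>\<lambda> = (1 - c) / c\<close>. The Meixner polynomials \<open>p\<^sub>n\<close>, normalised by the generating function
  \<open>(1 - t/c)\<^sup>x (1 - t)\<^sup>-\<^sup>x\<^sup>-\<^sup>\<beta>\<close>, satisfy \<open>\<Delta> p\<^sub>m = - \<lambda> (p\<^sub>0 + \<dots> + p\<^sub>m\<^sub>-\<^sub>1)\<close>, and their squared norms are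
  proportional to \<open>h\<^sub>n = (\<beta>)\<^sub>n / (n! c\<^sup>n)\<close>. So, up to sign, \<open>\<Delta>\<close> has in the orthonormal basis the strictly
  upper triangular matrix with entries \<open>\<lambda> sqrt (h\<^sub>k / h\<^sub>m)\<close> for \<open>k < m\<close>, which are positive and decrease
  in \<open>\<beta>\<close>; hence so does its norm, strictly because the entries shrink by a uniform factor. For
  \<open>\<beta> = 1\<close> the matrix is Toeplitz with entries \<open>\<lambda> c\<^bsup>(m-k)/2\<^esup>\<close>: the Schur test bounds its norm by the sum
  of the first row, the vector of ones shows that this is asymptotically sharp, and the complete series
  sums to \<open>1 + 1 / sqrt c\<close>. For other \<open>\<beta>\<close> the entries are still dominated by a geometric Toeplitz matrix.
\<close>

section \<open>Meixner polynomials\<close>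

definition meixner_inner :: "real \<Rightarrow> real \<Rightarrow> real poly \<Rightarrow> real poly \<Rightarrow> real" where
  "meixner_inner c \<beta> p q = (\<Sum>k. pochhammer \<beta> k / fact k * c ^ k * (poly p (real k) * poly q (real k)))"

definition diff_poly :: "real poly \<Rightarrow> real poly" where
  "diff_poly p = p \<circ>\<^sub>p [:1, 1:] - p"

text \<open>\<open>\<beta>\<inverse>\<close> times this operator is the adjoint of \<^const>\<open>diff_poly\<close>, from the weight \<open>\<beta> + 1\<close> to the
  weight \<open>\<beta>\<close>, which gives orthogonality by induction with shifted parameter.\<close>
definition raise_poly :: "real \<Rightarrow> real \<Rightarrow> real poly \<Rightarrow> real poly" where
  "raise_poly c \<beta> p = smult (1 / c) ([:0, 1:] * (p \<circ>\<^sub>p [:-1, 1:])) - [:\<beta>, 1:] * p"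

primrec binom_poly :: "nat \<Rightarrow> real poly" where
  "binom_poly 0 = 1"
| "binom_poly (Suc j) = smult (1 / real (Suc j)) ([:- real j, 1:] * binom_poly j)"

text \<open>The coefficient of \<open>t\<^sup>n\<close> in \<open>(1 - t/c)\<^sup>x (1 - t)\<^sup>-\<^sup>x\<^sup>-\<^sup>\<beta> = (1 - t)\<^sup>-\<^sup>\<beta> (1 - (1 - c)/c * t/(1 - t))\<^sup>x\<close>,
  expanded in the binomial polynomials.\<close>
definition meixner_poly :: "real \<Rightarrow> real \<Rightarrow> nat \<Rightarrow> real poly" where
  "meixner_poly c \<beta> n = (\<Sum>j\<le>n. smult ((- ((1 - c) / c)) ^ j *
     (pochhammer (\<beta> + real j) (n - j) / fact (n - j))) (binom_poly j))"

lemma poly_diff_poly: "poly (diff_poly p) x = poly p (x + 1) - poly p x"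
  by (simp add: diff_poly_def poly_pcompose add_ac)

lemma fwd_diff_poly: "fwd_diff (poly p) = poly (diff_poly p)"
  by (auto simp: fwd_diff_def poly_diff_poly)

lemma poly_raise_poly:
  "poly (raise_poly c \<beta> p) x = x * poly p (x - 1) / c - (\<beta> + x) * poly p x"
  by (simp add: raise_poly_def poly_pcompose algebra_simps)

lemma poly_binom_poly: "poly (binom_poly j) x = x gchoose j"
  by (induction j) (simp_all add: gbinomial_mult_1 field_simps)

lemma binom_poly_neq_0: "binom_poly j \<noteq> 0"
  by (induction j) (simp_all del: mult_pCons_left)

lemma degree_binom_poly: "degree (binom_poly j) = j"
proof (induction j)
  case (Suc j)
  have "degree ([:- real j, 1:] * binom_poly j) = Suc (degree (binom_poly j))"
    by (subst degree_mult_eq) (simp_all only: binom_poly_neq_0, simp_all)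
  with Suc show ?case by (simp del: mult_pCons_left)
qed simp

lemma poly_meixner_poly:
  "poly (meixner_poly c \<beta> n) x = (\<Sum>j\<le>n. (- ((1 - c) / c)) ^ j *
     (pochhammer (\<beta> + real j) (n - j) / fact (n - j)) * (x gchoose j))"
  by (simp add: meixner_poly_def poly_sum poly_binom_poly)

lemma meixner_poly_0 [simp]: "meixner_poly c \<beta> 0 = 1"
  by (simp add: meixner_poly_def)

section \<open>Difference, parameter shift and raising relations\<close>

lemma gbinomial_diff: "((x + 1) gchoose Suc j) - (x gchoose Suc j) = (x gchoose j)" for x :: real
  by (simp add: gbinomial_Suc_Suc)

text \<open>Differencing turns \<open>x gchoose Suc j\<close> into \<open>x gchoose j\<close>, so
  coefficients move down one index; \<open>\<beta> + Suc j\<close> then reads as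
  \<open>(\<beta> + 1) + j\<close>, and one factor \<open>- ((1 - c) / c)\<close> is left
  over.\<close>

lemma diff_meixner_poly:
  "diff_poly (meixner_poly c \<beta> (Suc n)) = smult (- ((1 - c) / c)) (meixner_poly c (\<beta> + 1) n)"
proof -
  let ?r = "- ((1 - c) / c)"
  let ?d = "\<lambda>j. ?r ^ j * (pochhammer (\<beta> + real j) (Suc n - j) / fact (Suc n - j))"
  have "poly (diff_poly (meixner_poly c \<beta> (Suc n))) x = poly (smult ?r (meixner_poly c (\<beta> + 1) n)) x" for x
  proof -
    have "poly (diff_poly (meixner_poly c \<beta> (Suc n))) x
        = (\<Sum>j\<le>Suc n. ?d j * (((x + 1) gchoose j) - (x gchoose j)))"
      unfolding poly_diff_poly poly_meixner_poly by (simp only: sum_subtractf right_diff_distrib)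
    also have "\<dots> = (\<Sum>j\<le>n. ?d (Suc j) * (x gchoose j))"
      by (subst sum.atMost_Suc_shift) (simp add: gbinomial_diff)
    also have "\<dots> = ?r * (\<Sum>j\<le>n. ?r ^ j * (pochhammer (\<beta> + 1 + real j) (n - j) / fact (n - j)) * (x gchoose j))"
      unfolding sum_distrib_left by (intro sum.cong refl) (simp add: add_ac)
    finally show ?thesis by (simp only: poly_smult poly_meixner_poly)
  qed
  thus ?thesis by (simp add: poly_eq_poly_eq_iff[symmetric] fun_eq_iff)
qed

text \<open>The numbers \<open>pochhammer b i / fact i\<close> are the coefficients of (1 - t)^(-b).
  This is (1 - t) (1 - t)^(-b-1) = (1 - t)^(-b), read off at t^(i+1).\<close>

lemma pochhammer_fact_diff:
  "pochhammer (b + 1) (Suc i) / fact (Suc i) - pochhammer (b + 1) i / fact i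
     = pochhammer b (Suc i) / (fact (Suc i) :: real)"
proof -
  have "pochhammer (b + 1) (Suc i) = pochhammer (b + 1) i * (b + 1 + real i)"
    by (simp add: pochhammer_Suc)
  moreover have "pochhammer b (Suc i) = b * pochhammer (b + 1) i"
    by (simp add: pochhammer_rec)
  moreover have "pochhammer (b + 1) i / fact i = pochhammer (b + 1) i * (real i + 1) / (fact (Suc i))"
    by (simp add: divide_simps)
  ultimately show ?thesis
    by (simp only: diff_divide_distrib[symmetric]) (simp add: algebra_simps)
qed

text \<open>The derivative of (1 - t)^(-b) is b (1 - t)^(-b-1), read off at t^i.\<close>

lemma pochhammer_fact_rec:
  "real (Suc i) * (pochhammer b (Suc i) / fact (Suc i)) = b * (pochhammer (b + 1) i / fact i)"
  by (simp add: pochhammer_rec divide_simps)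

text \<open>Raising \<beta> by one divides the generating function by 1 - t, which replaces
  coefficients by partial sums.\<close>

lemma meixner_poly_shift_param:
  "meixner_poly c (\<beta> + 1) n = (\<Sum>k\<le>n. meixner_poly c \<beta> k)"
proof (induction n)
  case (Suc n)
  let ?r = "- ((1 - c) / c)"
  let ?d = "\<lambda>b m j. ?r ^ j * (pochhammer (b + real j) (m - j) / fact (m - j))"
  have "poly (meixner_poly c (\<beta> + 1) (Suc n)) x
      = poly (meixner_poly c (\<beta> + 1) n + meixner_poly c \<beta> (Suc n)) x" for x
  proof -
    have *: "?d (\<beta> + 1) (Suc n) j = ?d (\<beta> + 1) n j + ?d \<beta> (Suc n) j" if "j \<le> n" for j
    proof -
      have "Suc n - j = Suc (n - j)" using that by simp
      thus ?thesis using pochhammer_fact_diff[of "\<beta> + real j" "n - j"]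
        by (simp only: distrib_left[symmetric]) (simp add: add_ac diff_eq_eq)
    qed
    \<comment> \<open>The top index n + 1 is left out here: its coefficient is a pure power of
      \<open>?r\<close>, the same for both parameters.\<close>
    have "(\<Sum>j\<le>n. ?d (\<beta> + 1) (Suc n) j * (x gchoose j)) =
        (\<Sum>j\<le>n. ?d (\<beta> + 1) n j * (x gchoose j)) + (\<Sum>j\<le>n. ?d \<beta> (Suc n) j * (x gchoose j))"
      unfolding sum.distrib[symmetric] using *
      by (intro sum.cong refl) (simp only: atMost_iff distrib_right)
    thus ?thesis by (simp add: poly_meixner_poly del: fact_Suc pochhammer_Suc)
  qed
  hence "meixner_poly c (\<beta> + 1) (Suc n) = meixner_poly c (\<beta> + 1) n + meixner_poly c \<beta> (Suc n)"
    by (simp only: poly_eq_poly_eq_iff[symmetric] fun_eq_iff) simp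
  with Suc show ?case by simp
qed simp

text \<open>In the binomial basis the raising operator sends index j to indices j and j + 1. The
  coefficient at j thus collects j copies of \<open>?d j\<close> from below and n + 1 - j copies
  from its own index.\<close>

lemma raise_meixner_poly:
  assumes "c \<noteq> 0"
  shows "raise_poly c \<beta> (meixner_poly c (\<beta> + 1) n) = smult (- real (Suc n)) (meixner_poly c \<beta> (Suc n))"
proof -
  let ?r = "- ((1 - c) / c)"
  let ?e = "\<lambda>j. ?r ^ j * (pochhammer (\<beta> + 1 + real j) (n - j) / fact (n - j))"
  let ?d = "\<lambda>j. ?r ^ j * (pochhammer (\<beta> + real j) (Suc n - j) / fact (Suc n - j))"
  have "poly (raise_poly c \<beta> (meixner_poly c (\<beta> + 1) n)) x
      = poly (smult (- real (Suc n)) (meixner_poly c \<beta> (Suc n))) x" for x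
  proof -
    have raise: "x * ((x - 1) gchoose j) / c - (\<beta> + x) * (x gchoose j)
        = - ?r * (real (Suc j) * (x gchoose Suc j)) - (\<beta> + real j) * (x gchoose j)" for j
    proof -
      have 1: "x * ((x - 1) gchoose j) = real (Suc j) * (x gchoose Suc j)"
        by (simp only: gbinomial_absorption)
      have 2: "x * (x gchoose j) = real j * (x gchoose j) + real (Suc j) * (x gchoose Suc j)"
        by (rule gbinomial_mult_1)
      have "(\<beta> + x) * (x gchoose j) = (\<beta> + real j) * (x gchoose j) + real (Suc j) * (x gchoose Suc j)"
        by (simp only: distrib_right 2) 
      thus ?thesis unfolding 1 using assms by (simp add: field_simps)
    qed
    have d1: "- ?r * ?e j = - ?d (Suc j)" for j
      by (simp add: add_ac)
    have d2: "(\<beta> + real j) * ?e j = real (Suc n - j) * ?d j" if "j \<le> n" for j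
    proof -
      have "Suc n - j = Suc (n - j)" using that by simp
      thus ?thesis
        using arg_cong[OF pochhammer_fact_rec[of "n - j" "\<beta> + real j"], of "\<lambda>x. ?r ^ j * x"]
        by (simp only: mult_ac add_ac)
    qed
    have "poly (raise_poly c \<beta> (meixner_poly c (\<beta> + 1) n)) x
        = (\<Sum>j\<le>n. ?e j * (x * ((x - 1) gchoose j) / c - (\<beta> + x) * (x gchoose j)))"
      unfolding poly_raise_poly poly_meixner_poly
      by (simp add: sum_distrib_left sum_divide_distrib sum_subtractf right_diff_distrib diff_divide_distrib mult_ac)
    also have "\<dots> = (\<Sum>j\<le>n. (- ?r * ?e j) * (real (Suc j) * (x gchoose Suc j))
         - ((\<beta> + real j) * ?e j) * (x gchoose j))"
      unfolding raise by (simp only: right_diff_distrib mult_ac)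
    also have "\<dots> = (\<Sum>j\<le>n. - (?d (Suc j) * real (Suc j) * (x gchoose Suc j))
         - real (Suc n - j) * ?d j * (x gchoose j))"
    proof (intro sum.cong refl)
      fix j assume "j \<in> {..n}"
      hence j: "j \<le> n" by simp
      show "(- ?r * ?e j) * (real (Suc j) * (x gchoose Suc j)) - ((\<beta> + real j) * ?e j) * (x gchoose j)
          = - (?d (Suc j) * real (Suc j) * (x gchoose Suc j)) - real (Suc n - j) * ?d j * (x gchoose j)"
        unfolding d1 d2[OF j] by (simp only: mult.assoc mult_minus_left)
    qed
    \<comment> \<open>Both sums extend to the full range, as the factor j vanishes at 0 and the
      factor n + 1 - j vanishes at n + 1.\<close>
    also have "\<dots> = - ((\<Sum>j\<le>Suc n. ?d j * real j * (x gchoose j))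
         + (\<Sum>j\<le>Suc n. real (Suc n - j) * ?d j * (x gchoose j)))"
      by (subst sum.atMost_Suc_shift[of "\<lambda>j. ?d j * real j * (x gchoose j)"])
         (simp add: sum_subtractf sum_negf del: fact_Suc pochhammer_Suc)
    also have "\<dots> = - (\<Sum>j\<le>Suc n. real (Suc n) * (?d j * (x gchoose j)))"
      unfolding sum.distrib[symmetric]
    proof (intro arg_cong[where f = uminus] sum.cong refl)
      fix j assume "j \<in> {..Suc n}"
      hence *: "real (Suc n) = real j + real (Suc n - j)" by (simp add: of_nat_diff)
      thus "?d j * real j * (x gchoose j) + real (Suc n - j) * ?d j * (x gchoose j)
          = real (Suc n) * (?d j * (x gchoose j))"
        unfolding * by (simp only: distrib_right distrib_left mult_ac)
    qed
    finally show ?thesis by (simp only: poly_smult poly_meixner_poly sum_distrib_left[symmetric] mult_minus_left)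
  qed
  thus ?thesis by (simp only: poly_eq_poly_eq_iff[symmetric] fun_eq_iff) simp
qed

section \<open>The weighted inner product and orthogonality\<close>

lemma summable_meixner_inner:
  assumes "0 < c" "c < 1" "0 < \<beta>"
  shows "summable (\<lambda>k. pochhammer \<beta> k / fact k * c ^ k * (poly p (real k) * poly q (real k)))"
  using meixner_summable_poly[OF assms, of "p * q"] by simp

lemma meixner_inner_commute: "meixner_inner c \<beta> p q = meixner_inner c \<beta> q p"
  by (simp add: meixner_inner_def mult_ac)

lemma meixner_inner_0 [simp]: "meixner_inner c \<beta> p 0 = 0" "meixner_inner c \<beta> 0 p = 0"
  by (simp_all add: meixner_inner_def)

lemma meixner_inner_smult_left:
  assumes "0 < c" "c < 1" "0 < \<beta>"
  shows "meixner_inner c \<beta> (smult a p) q = a * meixner_inner c \<beta> p q"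
  unfolding meixner_inner_def suminf_mult[OF summable_meixner_inner[OF assms], symmetric]
  by (simp add: mult_ac)

lemma meixner_inner_smult_right:
  assumes "0 < c" "c < 1" "0 < \<beta>"
  shows "meixner_inner c \<beta> p (smult a q) = a * meixner_inner c \<beta> p q"
  using meixner_inner_smult_left[OF assms] by (metis meixner_inner_commute)

lemma meixner_inner_sum_left:
  assumes "0 < c" "c < 1" "0 < \<beta>"
  shows "meixner_inner c \<beta> (\<Sum>i\<in>I. p i) q = (\<Sum>i\<in>I. meixner_inner c \<beta> (p i) q)"
  unfolding meixner_inner_def suminf_sum[OF summable_meixner_inner[OF assms], symmetric]
  by (simp add: poly_sum sum_distrib_left sum_distrib_right)

lemma meixner_inner_sum_right:
  assumes "0 < c" "c < 1" "0 < \<beta>"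
  shows "meixner_inner c \<beta> p (\<Sum>i\<in>I. q i) = (\<Sum>i\<in>I. meixner_inner c \<beta> p (q i))"
  using meixner_inner_sum_left[OF assms] by (subst (1 2) meixner_inner_commute)

lemma meixner_inner_one_one_pos:
  assumes "0 < c" "c < 1" "0 < \<beta>"
  shows "meixner_inner c \<beta> 1 1 > 0"
  unfolding meixner_inner_def
  using summable_meixner_inner[OF assms, of 1 1] meixner_weight_pos[OF assms]
  by (intro suminf_pos) simp_all

lemma meixner_norm_sq_inner:
  assumes "0 < c" "c < 1" "0 < \<beta>"
  shows "(meixner_norm c \<beta> (poly p))\<^sup>2 = meixner_inner c \<beta> p p"
proof -
  have "poly p \<in> poly_space (degree p)" by (auto simp: poly_space_def)
  from meixner_norm_sq[OF assms this] show ?thesis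
    by (simp only: meixner_inner_def power2_eq_square[of "poly p _"])
qed

text \<open>The mass is (1 - c)^(-\<beta>), but only the ratio for consecutive parameters matters,
  and \<open>pochhammer_fact_diff\<close> yields it without evaluating the series.\<close>

lemma meixner_mass_shift:
  assumes "0 < c" "c < 1" "0 < \<beta>"
  shows "(1 - c) * meixner_inner c (\<beta> + 1) 1 1 = meixner_inner c \<beta> 1 1"
proof -
  let ?u = "\<lambda>b k. pochhammer b k / fact k * c ^ k :: real"
  have S: "summable (?u b)" if "b > 0" for b
    using summable_meixner_inner[OF assms(1,2) that, of 1 1] by simp
  have S1: "summable (?u (\<beta> + 1))" and S0: "summable (?u \<beta>)" using S assms by auto
  have step: "?u (\<beta> + 1) (Suc k) - c * ?u (\<beta> + 1) k = ?u \<beta> (Suc k)" for k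
  proof -
    have "?u (\<beta> + 1) (Suc k) - c * ?u (\<beta> + 1) k
        = c ^ Suc k * (pochhammer (\<beta> + 1) (Suc k) / fact (Suc k) - pochhammer (\<beta> + 1) k / fact k)"
      by (simp only: right_diff_distrib power_Suc mult_ac)
    thus ?thesis by (simp only: pochhammer_fact_diff mult.commute)
  qed
  have "suminf (?u \<beta>) = 1 + (\<Sum>k. ?u \<beta> (Suc k))"
    using suminf_split_head[OF S0] by simp
  also have "(\<Sum>k. ?u \<beta> (Suc k)) = (\<Sum>k. ?u (\<beta> + 1) (Suc k)) - (\<Sum>k. c * ?u (\<beta> + 1) k)"
    unfolding step[symmetric]
    by (rule suminf_diff[OF summable_Suc_iff[THEN iffD2, OF S1] summable_mult[OF S1], symmetric])
  also have "(\<Sum>k. ?u (\<beta> + 1) (Suc k)) = suminf (?u (\<beta> + 1)) - 1"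
    using suminf_split_head[OF S1] by simp
  also have "(\<Sum>k. c * ?u (\<beta> + 1) k) = c * suminf (?u (\<beta> + 1))"
    by (rule suminf_mult[OF S1])
  finally show ?thesis by (simp add: meixner_inner_def left_diff_distrib)
qed

text \<open>Summation by parts: after an index shift in the part with p(x - 1), both parts carry
  \<beta> times the weight of \<beta> + 1, and the difference falls on q.\<close>

lemma meixner_inner_raise:
  assumes "0 < c" "c < 1" "0 < \<beta>"
  shows "meixner_inner c \<beta> (raise_poly c \<beta> p) q = \<beta> * meixner_inner c (\<beta> + 1) p (diff_poly q)"
proof -
  let ?u = "\<lambda>b k. pochhammer b k / fact k * c ^ k :: real"
  have b1: "\<beta> + 1 > 0" using assms by simp
  have wt1: "?u \<beta> k * (\<beta> + real k) = \<beta> * ?u (\<beta> + 1) k" for k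
  proof -
    have "pochhammer \<beta> k * (\<beta> + real k) = \<beta> * pochhammer (\<beta> + 1) k"
      using pochhammer_rec[of \<beta> k] pochhammer_Suc[of \<beta> k] by simp
    moreover have "?u \<beta> k * (\<beta> + real k) = pochhammer \<beta> k * (\<beta> + real k) / fact k * c ^ k"
      by simp
    ultimately show ?thesis by simp
  qed
  have wt2: "?u \<beta> (Suc k) * real (Suc k) / c = \<beta> * ?u (\<beta> + 1) k" for k
    using assms(1) arg_cong[OF pochhammer_fact_rec[of k \<beta>], of "\<lambda>x. c ^ k * x"]
    by (simp add: mult_ac del: fact_Suc pochhammer_Suc of_nat_Suc)
  let ?f = "\<lambda>k. ?u \<beta> k * real k / c * (poly p (real k - 1) * poly q (real k))"
  let ?g = "\<lambda>k. \<beta> * (?u (\<beta> + 1) k * (poly p (real k) * poly q (real k)))"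
  have f_Suc: "?f (Suc k) = \<beta> * (?u (\<beta> + 1) k * (poly p (real k) * poly (q \<circ>\<^sub>p [:1, 1:]) (real k)))" for k
    unfolding wt2 by (simp add: poly_pcompose add_ac mult_ac)
  have Sf': "summable (\<lambda>k. ?f (Suc k))"
    unfolding f_Suc by (intro summable_mult summable_meixner_inner[OF assms(1,2) b1])
  hence Sf: "summable ?f" by (subst (asm) summable_Suc_iff)
  have Sg: "summable ?g"
    by (intro summable_mult summable_meixner_inner[OF assms(1,2) b1])
  have "meixner_inner c \<beta> (raise_poly c \<beta> p) q = (\<Sum>k. ?f k - ?g k)"
    unfolding meixner_inner_def
  proof (intro suminf_cong)
    fix k
    have "?u \<beta> k * (poly (raise_poly c \<beta> p) (real k) * poly q (real k)) =
        ?f k - (?u \<beta> k * (\<beta> + real k)) * (poly p (real k) * poly q (real k))"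
      unfolding poly_raise_poly by (simp add: algebra_simps add_divide_distrib)
    thus "?u \<beta> k * (poly (raise_poly c \<beta> p) (real k) * poly q (real k)) = ?f k - ?g k"
      unfolding wt1 by (simp only: mult.assoc)
  qed
  also have "\<dots> = suminf ?f - suminf ?g" by (rule suminf_diff[OF Sf Sg, symmetric])
  \<comment> \<open>The term at 0 contains the factor \<open>real 0\<close>, so the shift leaves no
    boundary term.\<close>
  also have "suminf ?f = (\<Sum>k. ?f (Suc k))" using suminf_split_head[OF Sf] by simp
  also have "\<dots> - suminf ?g = (\<Sum>k. ?f (Suc k) - ?g k)" by (rule suminf_diff[OF Sf' Sg])
  also have "\<dots> = (\<Sum>k. \<beta> * (?u (\<beta> + 1) k * (poly p (real k) * poly (diff_poly q) (real k))))"
    unfolding f_Suc by (intro suminf_cong) (simp add: poly_diff_poly poly_pcompose algebra_simps)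
  also have "\<dots> = \<beta> * meixner_inner c (\<beta> + 1) p (diff_poly q)"
    unfolding meixner_inner_def by (intro suminf_mult summable_meixner_inner[OF assms(1,2) b1])
  finally show ?thesis .
qed

lemma diff_poly_1 [simp]: "diff_poly 1 = 0"
  by (simp add: poly_eq_poly_eq_iff[symmetric] fun_eq_iff poly_diff_poly)

lemma meixner_inner_Suc_left:
  assumes "0 < c" "c < 1" "0 < \<beta>"
  shows "meixner_inner c \<beta> (meixner_poly c \<beta> (Suc n)) q
    = - (\<beta> / real (Suc n)) * meixner_inner c (\<beta> + 1) (meixner_poly c (\<beta> + 1) n) (diff_poly q)"
proof -
  have "- real (Suc n) * meixner_inner c \<beta> (meixner_poly c \<beta> (Suc n)) q
      = \<beta> * meixner_inner c (\<beta> + 1) (meixner_poly c (\<beta> + 1) n) (diff_poly q)"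
    using meixner_inner_raise[OF assms, of "meixner_poly c (\<beta> + 1) n" q]
    by (simp only: raise_meixner_poly[OF less_imp_neq[OF assms(1), symmetric]]
        meixner_inner_smult_left[OF assms])
  thus ?thesis by (simp add: field_simps del: of_nat_Suc)
qed

text \<open>The squared norm of \<open>meixner_poly c \<beta> n\<close> relative to that of \<open>1\<close>.\<close>
definition meixner_sqnorm :: "real \<Rightarrow> real \<Rightarrow> nat \<Rightarrow> real" where
  "meixner_sqnorm c \<beta> n = pochhammer \<beta> n / fact n / c ^ n"

lemma meixner_sqnorm_pos: "0 < c \<Longrightarrow> 0 < \<beta> \<Longrightarrow> meixner_sqnorm c \<beta> n > 0"
  by (simp add: meixner_sqnorm_def pochhammer_pos)

text \<open>Each step lowers both indices and passes to \<beta> + 1, hence the induction with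
  \<beta> arbitrary. If just one index reaches 0, differencing the constant 1 gives 0.\<close>

lemma meixner_orthogonal:
  assumes "0 < c" "c < 1" "0 < \<beta>"
  shows "meixner_inner c \<beta> (meixner_poly c \<beta> n) (meixner_poly c \<beta> m)
    = (if n = m then meixner_sqnorm c \<beta> n * meixner_inner c \<beta> 1 1 else 0)"
  using assms(3)
proof (induction n arbitrary: m \<beta>)
  case 0
  have "meixner_inner c \<beta> (meixner_poly c \<beta> (Suc k)) 1 = 0" for k
    unfolding meixner_inner_Suc_left[OF assms(1,2) 0] by simp
  hence "meixner_inner c \<beta> 1 (meixner_poly c \<beta> (Suc k)) = 0" for k
    by (metis meixner_inner_commute)
  thus ?case by (cases m) (simp_all add: meixner_sqnorm_def)
next
  case (Suc n)
  have b1: "\<beta> + 1 > 0" using Suc.prems by simp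
  show ?case
  proof (cases m)
    case 0
    thus ?thesis unfolding meixner_inner_Suc_left[OF assms(1,2) Suc.prems] by simp
  next
    case m: (Suc k)
    let ?M = "meixner_inner c (\<beta> + 1) 1 1"
    have *: "meixner_inner c \<beta> (meixner_poly c \<beta> (Suc n)) (meixner_poly c \<beta> m)
      = \<beta> / real (Suc n) * ((1 - c) / c) * (if n = k then meixner_sqnorm c (\<beta> + 1) n * ?M else 0)"
      unfolding meixner_inner_Suc_left[OF assms(1,2) Suc.prems] m diff_meixner_poly
        meixner_inner_smult_right[OF assms(1,2) b1] Suc.IH[OF b1] by simp
    \<comment> \<open>The factor 1 - c from the difference relation converts the mass at \<beta> + 1
      into the mass at \<beta>.\<close>
    have "\<beta> / real (Suc n) * ((1 - c) / c) * (meixner_sqnorm c (\<beta> + 1) n * ?M)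
      = (\<beta> * (pochhammer (\<beta> + 1) n / fact n)) / real (Suc n) / c ^ Suc n * ((1 - c) * ?M)"
      by (simp add: meixner_sqnorm_def field_simps)
    also have "\<dots> = meixner_sqnorm c \<beta> (Suc n) * meixner_inner c \<beta> 1 1"
      unfolding pochhammer_fact_rec[symmetric] meixner_mass_shift[OF assms(1,2) Suc.prems]
      by (simp add: meixner_sqnorm_def del: fact_Suc pochhammer_Suc of_nat_Suc)
    finally show ?thesis unfolding * using m by (cases "n = k") (simp_all only: if_True if_False, simp_all)
  qed
qed

section \<open>Expansions in the Meixner basis\<close>

lemma meixner_norm_expansion:
  assumes "0 < c" "c < 1" "0 < \<beta>"
  shows "(meixner_norm c \<beta> (poly (\<Sum>k\<le>n. smult (b k) (meixner_poly c \<beta> k))))\<^sup>2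
    = meixner_inner c \<beta> 1 1 * (\<Sum>k\<le>n. meixner_sqnorm c \<beta> k * (b k)\<^sup>2)"
proof -
  have "(meixner_norm c \<beta> (poly (\<Sum>k\<le>n. smult (b k) (meixner_poly c \<beta> k))))\<^sup>2
     = (\<Sum>k\<le>n. \<Sum>m\<le>n. b k * (b m * meixner_inner c \<beta> (meixner_poly c \<beta> k) (meixner_poly c \<beta> m)))"
    unfolding meixner_norm_sq_inner[OF assms] meixner_inner_sum_left[OF assms]
    unfolding meixner_inner_sum_right[OF assms]
      meixner_inner_smult_left[OF assms] meixner_inner_smult_right[OF assms]
    by (simp only: sum_distrib_left mult_ac)
  also have "\<dots> = (\<Sum>k\<le>n. \<Sum>m\<le>n. if k = m then b k * (b m * (meixner_sqnorm c \<beta> k * meixner_inner c \<beta> 1 1)) else 0)"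
    by (intro sum.cong refl) (simp add: meixner_orthogonal[OF assms])
  also have "\<dots> = (\<Sum>k\<le>n. b k * (b k * (meixner_sqnorm c \<beta> k * meixner_inner c \<beta> 1 1)))"
    by (intro sum.cong refl) (simp add: sum.delta')
  finally show ?thesis by (simp add: sum_distrib_left power2_eq_square mult_ac)
qed

lemma diff_meixner_poly_sum:
  "diff_poly (meixner_poly c \<beta> n) = smult (- ((1 - c) / c)) (\<Sum>k<n. meixner_poly c \<beta> k)"
  by (cases n) (simp_all add: diff_meixner_poly meixner_poly_shift_param lessThan_Suc_atMost)

text \<open>Index m contributes to every lower index, so exchanging the sums turns coefficients into
  tail sums.\<close>

lemma diff_poly_expansion:
  "diff_poly (\<Sum>m\<le>n. smult (b m) (meixner_poly c \<beta> m))
    = (\<Sum>k\<le>n. smult (- ((1 - c) / c) * (\<Sum>m\<in>{k<..n}. b m)) (meixner_poly c \<beta> k))"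
proof -
  let ?r = "- ((1 - c) / c)"
  let ?P = "meixner_poly c \<beta>"
  have "diff_poly (\<Sum>m\<le>n. smult (b m) (?P m)) = (\<Sum>m\<le>n. smult (b m) (diff_poly (?P m)))"
    by (simp add: poly_eq_poly_eq_iff[symmetric] fun_eq_iff poly_diff_poly poly_sum sum_subtractf right_diff_distrib)
  \<comment> \<open>Writing the inner range inside k <= n exhibits a restricted square, whose two
    sums can be exchanged.\<close>
  also have "\<dots> = (\<Sum>m\<le>n. \<Sum>k | k \<le> n \<and> k < m. smult (?r * b m) (?P k))"
  proof (intro sum.cong refl)
    fix m assume "m \<in> {..n}"
    hence "{k. k \<le> n \<and> k < m} = {..<m}" by auto
    thus "smult (b m) (diff_poly (?P m)) = (\<Sum>k | k \<le> n \<and> k < m. smult (?r * b m) (?P k))"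
      unfolding diff_meixner_poly_sum by (intro poly_eqI) (simp add: coeff_sum sum_distrib_left sum_negf mult_ac)
  qed
  also have "\<dots> = (\<Sum>k\<le>n. \<Sum>m | m \<le> n \<and> k < m. smult (?r * b m) (?P k))"
    unfolding atMost_def using sum.swap_restrict[of "{k. k \<le> n}" "{k. k \<le> n}" "\<lambda>m k. smult (?r * b m) (?P k)" "\<lambda>m k. k < m"] by simp
  also have "\<dots> = (\<Sum>k\<le>n. smult (?r * (\<Sum>m\<in>{k<..n}. b m)) (?P k))"
    by (intro sum.cong refl) (auto simp: sum_distrib_left smult_sum intro!: sum.cong)
  finally show ?thesis .
qed

text \<open>Only the term j = n reaches degree n, and it carries a nonzero power of (1 - c) /
  c.\<close>

lemma degree_meixner_poly:
  assumes "c \<noteq> 0" "c \<noteq> 1"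
  shows "degree (meixner_poly c \<beta> n) = n"
proof (rule antisym)
  show "degree (meixner_poly c \<beta> n) \<le> n"
    unfolding meixner_poly_def by (intro degree_sum_le) (simp_all add: degree_binom_poly)
  have "coeff (meixner_poly c \<beta> n) n = (\<Sum>j\<le>n. if j = n then (- ((1 - c) / c)) ^ n * lead_coeff (binom_poly n) else 0)"
    unfolding meixner_poly_def coeff_sum
    by (intro sum.cong refl) (auto simp: degree_binom_poly coeff_eq_0)
  also have "\<dots> \<noteq> 0" using assms by (simp add: binom_poly_neq_0)
  finally show "n \<le> degree (meixner_poly c \<beta> n)" by (rule le_degree)
qed

lemma poly_expansion_graded:
  fixes P :: "nat \<Rightarrow> 'a :: field poly"
  assumes P: "\<And>k. degree (P k) = k" "P 0 \<noteq> 0" and "degree p \<le> n"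
  shows "\<exists>b. p = (\<Sum>k\<le>n. smult (b k) (P k))"
  using assms(3)
proof (induction n arbitrary: p)
  case 0
  then obtain a where "p = [:a:]" by (auto elim: degree_eq_zeroE)
  moreover obtain d where "P 0 = [:d:]" using P(1)[of 0] by (auto elim: degree_eq_zeroE)
  ultimately show ?case using P(2) by (intro exI[of _ "\<lambda>_. a / d"]) simp
next
  case (Suc n)
  let ?a = "coeff p (Suc n) / coeff (P (Suc n)) (Suc n)"
  have nz: "coeff (P (Suc n)) (Suc n) \<noteq> 0"
    using P(1)[of "Suc n"] by (metis leading_coeff_0_iff degree_0 nat.distinct(1))
  have "degree (p - smult ?a (P (Suc n))) \<le> n"
  proof (rule degree_le, intro allI impI)
    fix i assume "n < i"
    then consider "i = Suc n" | "i > Suc n" by linarith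
    thus "coeff (p - smult ?a (P (Suc n))) i = 0"
    proof cases
      case 2
      thus ?thesis using Suc.prems P(1)[of "Suc n"] by (simp add: coeff_eq_0)
    qed (simp add: nz)
  qed
  from Suc.IH[OF this] obtain b where "p - smult ?a (P (Suc n)) = (\<Sum>k\<le>n. smult (b k) (P k))" by blast
  hence "p = (\<Sum>k\<le>Suc n. smult ((b(Suc n := ?a)) k) (P k))"
    by (simp add: diff_eq_eq)
  thus ?case by blast
qed

section \<open>The matrix of the difference operator\<close>

text \<open>The sign of the matrix is dropped, since rows enter \<open>markov_form\<close> only
  squared.\<close>

definition markov_entry :: "real \<Rightarrow> real \<Rightarrow> nat \<Rightarrow> nat \<Rightarrow> real" where
  "markov_entry c \<beta> k m = (1 - c) / c * sqrt (meixner_sqnorm c \<beta> k / meixner_sqnorm c \<beta> m)"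

definition markov_form :: "real \<Rightarrow> real \<Rightarrow> nat \<Rightarrow> (nat \<Rightarrow> real) \<Rightarrow> real" where
  "markov_form c \<beta> n a = (\<Sum>k\<le>n. (\<Sum>m\<in>{k<..n}. markov_entry c \<beta> k m * a m)\<^sup>2)"

lemma markov_entry_pos: "0 < c \<Longrightarrow> c < 1 \<Longrightarrow> 0 < \<beta> \<Longrightarrow> markov_entry c \<beta> k m > 0"
  by (simp add: markov_entry_def meixner_sqnorm_pos)

text \<open>Consecutive squared norms have ratio (j + \<beta>) / ((j + 1) c), so their quotient
  telescopes. In the product each factor visibly decreases in \<beta>.\<close>

lemma markov_entry_eq:
  assumes "0 < c" "0 < \<beta>" "k \<le> m"
  shows "markov_entry c \<beta> k m = (1 - c) / c * sqrt (c ^ (m - k) * (\<Prod>j\<in>{k..<m}. (real j + 1) / (real j + \<beta>)))"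
proof -
  have pf: "pochhammer \<beta> m / fact m = pochhammer \<beta> k / fact k * (\<Prod>j\<in>{k..<m}. (real j + \<beta>) / (real j + 1))"
    using assms(3)
  proof (induction m rule: dec_induct)
    case (step m)
    have "pochhammer \<beta> (Suc m) / fact (Suc m) = pochhammer \<beta> m / fact m * ((real m + \<beta>) / (real m + 1))"
      by (simp add: pochhammer_Suc add_ac)
    with step show ?case by simp
  qed simp
  define Q where "Q = (\<Prod>j\<in>{k..<m}. (real j + 1) / (real j + \<beta>))"
  have cm: "c ^ m = c ^ k * c ^ (m - k)" using assms(3) by (simp flip: power_add)
  have inv: "(\<Prod>j\<in>{k..<m}. (real j + \<beta>) / (real j + 1)) = inverse Q"
    by (simp add: Q_def prod_inversef[symmetric])
  have "Q \<noteq> 0"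
    using assms by (auto simp: Q_def add_eq_0_iff)
  moreover have "pochhammer \<beta> k \<noteq> 0" using pochhammer_pos[OF assms(2), of k] by simp
  ultimately have "meixner_sqnorm c \<beta> k / meixner_sqnorm c \<beta> m
      = c ^ (m - k) * Q"
    unfolding meixner_sqnorm_def pf inv cm using assms(1) by (simp add: field_simps)
  thus ?thesis by (simp add: markov_entry_def Q_def)
qed

text \<open>Vectors give polynomials, for lower bounds on the constant; polynomials give vectors,
  for upper bounds.\<close>

lemma markov_form_expansion:
  assumes "0 < c" "c < 1" "0 < \<beta>"
  shows "\<exists>p. degree p \<le> n \<and>
    (meixner_norm c \<beta> (poly p))\<^sup>2 = meixner_inner c \<beta> 1 1 * (\<Sum>k\<le>n. (a k)\<^sup>2) \<and>
    (meixner_norm c \<beta> (fwd_diff (poly p)))\<^sup>2 = meixner_inner c \<beta> 1 1 * markov_form c \<beta> n a"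
    and "degree p \<le> n \<Longrightarrow> \<exists>a.
    (meixner_norm c \<beta> (poly p))\<^sup>2 = meixner_inner c \<beta> 1 1 * (\<Sum>k\<le>n. (a k)\<^sup>2) \<and>
    (meixner_norm c \<beta> (fwd_diff (poly p)))\<^sup>2 = meixner_inner c \<beta> 1 1 * markov_form c \<beta> n a"
proof -
  let ?h = "meixner_sqnorm c \<beta>"
  let ?P = "meixner_poly c \<beta>"
  have h: "?h k > 0" for k using meixner_sqnorm_pos assms by blast
  have *: "(meixner_norm c \<beta> (poly p))\<^sup>2 = meixner_inner c \<beta> 1 1 * (\<Sum>k\<le>n. (a k)\<^sup>2) \<and>
    (meixner_norm c \<beta> (fwd_diff (poly p)))\<^sup>2 = meixner_inner c \<beta> 1 1 * markov_form c \<beta> n a"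
    if p: "p = (\<Sum>k\<le>n. smult (a k / sqrt (?h k)) (?P k))" for a p
  proof -
    have 1: "?h k * (a k / sqrt (?h k))\<^sup>2 = (a k)\<^sup>2" for k
      using h[of k] by (simp add: power_divide)
    have 2: "?h k * (- ((1 - c) / c) * (\<Sum>m\<in>{k<..n}. a m / sqrt (?h m)))\<^sup>2
        = (\<Sum>m\<in>{k<..n}. markov_entry c \<beta> k m * a m)\<^sup>2" for k
    proof -
      have "(\<Sum>m\<in>{k<..n}. markov_entry c \<beta> k m * a m)
          = sqrt (?h k) * ((1 - c) / c * (\<Sum>m\<in>{k<..n}. a m / sqrt (?h m)))"
        by (simp add: markov_entry_def sum_distrib_left real_sqrt_divide mult_ac)
      thus ?thesis using h[of k]
        by (simp only: power_mult_distrib power2_minus real_sqrt_pow2 less_imp_le)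
    qed
    show ?thesis
      unfolding fwd_diff_poly p diff_poly_expansion meixner_norm_expansion[OF assms] 1 2 markov_form_def by simp
  qed
  have degP: "degree (?P k) = k" for k using assms by (intro degree_meixner_poly) auto
  let ?p = "\<Sum>k\<le>n. smult (a k / sqrt (?h k)) (?P k)"
  have "degree ?p \<le> n" by (intro degree_sum_le) (simp_all add: degP)
  with *[OF refl, of a] show "\<exists>p. degree p \<le> n \<and>
    (meixner_norm c \<beta> (poly p))\<^sup>2 = meixner_inner c \<beta> 1 1 * (\<Sum>k\<le>n. (a k)\<^sup>2) \<and>
    (meixner_norm c \<beta> (fwd_diff (poly p)))\<^sup>2 = meixner_inner c \<beta> 1 1 * markov_form c \<beta> n a" by (intro exI[of _ ?p] conjI) blast+
  assume "degree p \<le> n"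
  then obtain b where b: "p = (\<Sum>k\<le>n. smult (b k) (?P k))"
    using poly_expansion_graded[of ?P, OF degP] by auto
  \<comment> \<open>The witness is \<open>b k * sqrt (?h k)\<close>, the coordinate in the
    normalised basis.\<close>
  hence "p = (\<Sum>k\<le>n. smult (b k * sqrt (?h k) / sqrt (?h k)) (?P k))"
    using h by (simp add: less_imp_neq[symmetric])
  from *[OF this] show "\<exists>a.
    (meixner_norm c \<beta> (poly p))\<^sup>2 = meixner_inner c \<beta> 1 1 * (\<Sum>k\<le>n. (a k)\<^sup>2) \<and>
    (meixner_norm c \<beta> (fwd_diff (poly p)))\<^sup>2 = meixner_inner c \<beta> 1 1 * markov_form c \<beta> n a" by (intro exI)
qed

section \<open>The constant as a matrix norm\<close>

lemma markov_const_nonneg: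
  assumes "0 < c" "c < 1" "0 < \<beta>"
  shows "markov_const n c \<beta> \<ge> 0"
proof -
  have 1: "poly 1 \<in> poly_space n" unfolding poly_space_def by (intro CollectI exI[of _ 1]) simp
  have "(meixner_norm c \<beta> (poly 1))\<^sup>2 > 0"
    unfolding meixner_norm_sq_inner[OF assms] by (rule meixner_inner_one_one_pos[OF assms])
  hence "meixner_norm c \<beta> (poly 1) > 0"
    using meixner_norm_nonneg[OF assms 1] by (simp add: zero_less_power2)
  moreover have "0 \<le> markov_const n c \<beta> * meixner_norm c \<beta> (poly 1)"
    using meixner_norm_nonneg[OF assms fwd_diff_poly_space[OF assms 1]] markov_inequality[OF assms 1]
    by linarith
  ultimately show ?thesis by (simp add: zero_le_mult_iff)
qed

text \<open>The common mass cancels. Together with \<open>markov_const_le\<close> this identifies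
  the constant with the spectral norm of the matrix.\<close>

lemma markov_form_le:
  assumes "0 < c" "c < 1" "0 < \<beta>"
  shows "markov_form c \<beta> n a \<le> (markov_const n c \<beta>)\<^sup>2 * (\<Sum>k\<le>n. (a k)\<^sup>2)"
proof -
  obtain p where p: "degree p \<le> n"
    "(meixner_norm c \<beta> (poly p))\<^sup>2 = meixner_inner c \<beta> 1 1 * (\<Sum>k\<le>n. (a k)\<^sup>2)"
    "(meixner_norm c \<beta> (fwd_diff (poly p)))\<^sup>2 = meixner_inner c \<beta> 1 1 * markov_form c \<beta> n a"
    using markov_form_expansion(1)[OF assms] by blast
  have P: "poly p \<in> poly_space n" using p by (auto simp: poly_space_def)
  have "(meixner_norm c \<beta> (fwd_diff (poly p)))\<^sup>2 \<le> (markov_const n c \<beta> * meixner_norm c \<beta> (poly p))\<^sup>2"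
    using meixner_norm_nonneg[OF assms fwd_diff_poly_space[OF assms P]] markov_inequality[OF assms P]
    by (intro power_mono)
  hence "meixner_inner c \<beta> 1 1 * markov_form c \<beta> n a
      \<le> meixner_inner c \<beta> 1 1 * ((markov_const n c \<beta>)\<^sup>2 * (\<Sum>k\<le>n. (a k)\<^sup>2))"
    by (simp add: p power_mult_distrib mult_ac)
  thus ?thesis using meixner_inner_one_one_pos[OF assms] by simp
qed

lemma markov_const_le:
  assumes "0 < c" "c < 1" "0 < \<beta>" and "g \<ge> 0"
    and "\<And>a. markov_form c \<beta> n a \<le> g\<^sup>2 * (\<Sum>k\<le>n. (a k)\<^sup>2)"
  shows "markov_const n c \<beta> \<le> g"
proof (rule markov_const_least[OF assms(1-3)])
  fix f assume f: "f \<in> poly_space n"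
  then obtain p where p: "f = poly p" "degree p \<le> n" by (auto simp: poly_space_def)
  obtain a where a:
    "(meixner_norm c \<beta> f)\<^sup>2 = meixner_inner c \<beta> 1 1 * (\<Sum>k\<le>n. (a k)\<^sup>2)"
    "(meixner_norm c \<beta> (fwd_diff f))\<^sup>2 = meixner_inner c \<beta> 1 1 * markov_form c \<beta> n a"
    using markov_form_expansion(2)[OF assms(1-3) p(2)] p(1) by blast
  have "(meixner_norm c \<beta> (fwd_diff f))\<^sup>2 \<le> (g * meixner_norm c \<beta> f)\<^sup>2"
    unfolding power_mult_distrib a
    using mult_left_mono[OF assms(5)[of a] less_imp_le[OF meixner_inner_one_one_pos[OF assms(1-3)]]]
    by (simp add: mult_ac)
  thus "meixner_norm c \<beta> (fwd_diff f) \<le> g * meixner_norm c \<beta> f"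
    by (rule power2_le_imp_le) (intro mult_nonneg_nonneg assms(4) meixner_norm_nonneg[OF assms(1-3) f])
qed

text \<open>The unit vector at index 1, available for n >= 1, detects the positive entry (0, 1).
  Positivity makes the comparison in \<beta> strict.\<close>

lemma markov_const_pos:
  assumes "0 < c" "c < 1" "0 < \<beta>" and "n \<ge> 1"
  shows "markov_const n c \<beta> > 0"
proof -
  let ?a = "\<lambda>m::nat. if m = 1 then 1 else 0 :: real"
  have "0 < (markov_entry c \<beta> 0 1)\<^sup>2" using markov_entry_pos[OF assms(1-3)] by (simp add: less_imp_neq[symmetric])
  also have "(markov_entry c \<beta> 0 1)\<^sup>2 = (\<Sum>k\<in>{0}. (\<Sum>m\<in>{k<..n}. markov_entry c \<beta> k m * ?a m)\<^sup>2)"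
    using assms(4) by (simp add: if_distrib[of "\<lambda>x. _ * x"] cong: if_cong)
  also have "\<dots> \<le> markov_form c \<beta> n ?a"
    unfolding markov_form_def by (intro sum_mono2) auto
  also have "\<dots> \<le> (markov_const n c \<beta>)\<^sup>2 * (\<Sum>k\<le>n. (?a k)\<^sup>2)"
    by (rule markov_form_le[OF assms(1-3)])
  finally show ?thesis using markov_const_nonneg[OF assms(1-3), of n] by (cases "markov_const n c \<beta> = 0") auto
qed

section \<open>Monotonicity in \<beta>\<close>

lemma markov_form_mono:
  assumes "0 < c" "c < 1" "0 < \<beta>" "0 < \<beta>'" and "\<theta> \<ge> 0"
    and "\<And>k m. k < m \<Longrightarrow> m \<le> n \<Longrightarrow> markov_entry c \<beta>' k m \<le> \<theta> * markov_entry c \<beta> k m"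
  shows "markov_form c \<beta>' n a \<le> \<theta>\<^sup>2 * markov_form c \<beta> n (\<lambda>m. \<bar>a m\<bar>)"
proof -
  have "(\<Sum>m\<in>{k<..n}. markov_entry c \<beta>' k m * a m)\<^sup>2
      \<le> \<theta>\<^sup>2 * (\<Sum>m\<in>{k<..n}. markov_entry c \<beta> k m * \<bar>a m\<bar>)\<^sup>2" for k
  proof -
    \<comment> \<open>Entries are positive, so passing to absolute values of the vector lets
      entrywise domination be summed.\<close>
    have "\<bar>\<Sum>m\<in>{k<..n}. markov_entry c \<beta>' k m * a m\<bar> \<le> (\<Sum>m\<in>{k<..n}. markov_entry c \<beta>' k m * \<bar>a m\<bar>)"
      using markov_entry_pos[OF assms(1,2,4)]
      by (intro order.trans[OF sum_abs] sum_mono) (simp add: abs_mult less_imp_le)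
    also have "\<dots> \<le> (\<Sum>m\<in>{k<..n}. \<theta> * markov_entry c \<beta> k m * \<bar>a m\<bar>)"
      by (intro sum_mono mult_right_mono assms(6)) auto
    also have "\<dots> = \<theta> * (\<Sum>m\<in>{k<..n}. markov_entry c \<beta> k m * \<bar>a m\<bar>)"
      by (simp add: sum_distrib_left mult_ac)
    finally have "\<bar>\<Sum>m\<in>{k<..n}. markov_entry c \<beta>' k m * a m\<bar>\<^sup>2
        \<le> (\<theta> * (\<Sum>m\<in>{k<..n}. markov_entry c \<beta> k m * \<bar>a m\<bar>))\<^sup>2" by (intro power_mono) auto
    thus ?thesis by (simp add: power_mult_distrib)
  qed
  thus ?thesis unfolding markov_form_def sum_distrib_left by (intro sum_mono)
qed

text \<open>The gain comes from the factor j = k alone, present because k < m: (k + \<beta>) / (k +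
  \<beta>') grows with k, so its value at n is a bound independent of k and m.\<close>

lemma markov_entry_ratio:
  assumes "0 < c" "c < 1" "0 < \<beta>" "\<beta> < \<beta>'" "k < m" "m \<le> n"
  shows "markov_entry c \<beta>' k m \<le> sqrt ((real n + \<beta>) / (real n + \<beta>')) * markov_entry c \<beta> k m"
proof -
  let ?q = "\<lambda>b. \<Prod>j\<in>{k..<m}. (real j + 1) / (real j + b)"
  have head: "?q b = (real k + 1) / (real k + b) * (\<Prod>j\<in>{Suc k..<m}. (real j + 1) / (real j + b))" for b
    using assms(5) by (rule prod.atLeast_Suc_lessThan)
  have "(real k + 1) / (real k + \<beta>') \<le> (real n + \<beta>) / (real n + \<beta>') * ((real k + 1) / (real k + \<beta>))"
  proof -
    \<comment> \<open>This product is exactly the difference of the two sides after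
      cross-multiplication.\<close>
    have "(real n - real k) * (\<beta>' - \<beta>) \<ge> 0" using assms by simp
    hence "(real k + \<beta>) * (real n + \<beta>') \<le> (real n + \<beta>) * (real k + \<beta>')" by (simp add: algebra_simps)
    hence "(real k + \<beta>) / (real k + \<beta>') \<le> (real n + \<beta>) / (real n + \<beta>')"
      using assms by (simp add: divide_simps mult_ac)
    moreover have "(real k + 1) / (real k + \<beta>') = (real k + \<beta>) / (real k + \<beta>') * ((real k + 1) / (real k + \<beta>))"
      using assms(3) by simp
    ultimately show ?thesis using assms(3) by (metis add_nonneg_pos divide_nonneg_pos mult_right_mono of_nat_0_le_iff add_nonneg_nonneg zero_le_one)
  qed
  moreover have "(\<Prod>j\<in>{Suc k..<m}. (real j + 1) / (real j + \<beta>')) \<le> (\<Prod>j\<in>{Suc k..<m}. (real j + 1) / (real j + \<beta>))"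
    using assms by (intro prod_mono conjI divide_left_mono) auto
  ultimately have "?q \<beta>' \<le> (real n + \<beta>) / (real n + \<beta>') * ((real k + 1) / (real k + \<beta>))
       * (\<Prod>j\<in>{Suc k..<m}. (real j + 1) / (real j + \<beta>))"
    unfolding head using assms(3,4) by (intro mult_mono prod_nonneg) auto
  hence "?q \<beta>' \<le> (real n + \<beta>) / (real n + \<beta>') * ?q \<beta>"
    unfolding head by (simp only: mult.assoc)
  hence *: "c ^ (m - k) * ?q \<beta>' \<le> c ^ (m - k) * ((real n + \<beta>) / (real n + \<beta>') * ?q \<beta>)"
    using assms(1) by (intro mult_left_mono) auto
  have "(1 - c) / c * sqrt (c ^ (m - k) * ?q \<beta>')
      \<le> (1 - c) / c * sqrt (c ^ (m - k) * ((real n + \<beta>) / (real n + \<beta>') * ?q \<beta>))"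
    by (rule mult_left_mono[OF real_sqrt_le_mono[OF *]]) (use assms in simp)
  moreover have "\<beta>' > 0" "k \<le> m" using assms by auto
  ultimately show ?thesis using assms(1,3)
    by (simp only: markov_entry_eq real_sqrt_mult mult_ac)
qed

lemma markov_const_strict_antimono:
  assumes "0 < c" "c < 1" "0 < \<beta>" "\<beta> < \<beta>'" "n \<ge> 1"
  shows "markov_const n c \<beta>' < markov_const n c \<beta>"
proof -
  let ?\<theta> = "sqrt ((real n + \<beta>) / (real n + \<beta>'))"
  have b': "\<beta>' > 0" using assms by simp
  have "markov_const n c \<beta>' \<le> ?\<theta> * markov_const n c \<beta>"
  proof (rule markov_const_le[OF assms(1,2) b'])
    show "0 \<le> ?\<theta> * markov_const n c \<beta>" using assms markov_const_nonneg[OF assms(1-3), of n] by simp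
    fix a
    have "markov_form c \<beta>' n a \<le> ?\<theta>\<^sup>2 * markov_form c \<beta> n (\<lambda>m. \<bar>a m\<bar>)"
      using markov_entry_ratio[OF assms(1-4)] assms by (intro markov_form_mono b') auto
    also have "\<dots> \<le> ?\<theta>\<^sup>2 * ((markov_const n c \<beta>)\<^sup>2 * (\<Sum>k\<le>n. \<bar>a k\<bar>\<^sup>2))"
      by (intro mult_left_mono markov_form_le[OF assms(1-3)]) simp
    finally show "markov_form c \<beta>' n a \<le> (?\<theta> * markov_const n c \<beta>)\<^sup>2 * (\<Sum>k\<le>n. (a k)\<^sup>2)"
      by (simp only: power_mult_distrib power2_abs mult.assoc)
  qed
  \<comment> \<open>Here \<open>?\<theta> < 1\<close> because \<beta> < \<beta>'.\<close>
  also have "\<dots> < 1 * markov_const n c \<beta>"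
    using assms by (intro mult_strict_right_mono markov_const_pos) auto
  finally show ?thesis by simp
qed

section \<open>Toeplitz majorants\<close>

text \<open>Cauchy-Schwarz with the kernel split into two square roots bounds each row by a row sum
  times weighted squares; exchanging sums then brings in the column sums. Both kinds are sums of
  distinct \<open>t d\<close> with 0 < d <= n.\<close>

lemma toeplitz_schur_test:
  fixes t :: "nat \<Rightarrow> real"
  assumes t: "\<And>d. t d \<ge> 0" and A: "\<And>k m. k < m \<Longrightarrow> m \<le> n \<Longrightarrow> \<bar>A k m\<bar> \<le> t (m - k)"
  shows "(\<Sum>k\<le>n. (\<Sum>m\<in>{k<..n}. A k m * a m)\<^sup>2) \<le> (\<Sum>d\<in>{0<..n}. t d)\<^sup>2 * (\<Sum>k\<le>n. (a k)\<^sup>2)"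
proof -
  let ?T = "\<Sum>d\<in>{0<..n}. t d"
  have T: "?T \<ge> 0" using t by (intro sum_nonneg)
  have row: "(\<Sum>m\<in>{k<..n}. t (m - k)) \<le> ?T" for k
  proof -
    have "(\<Sum>m\<in>{k<..n}. t (m - k)) = (\<Sum>d\<in>{0<..n - k}. t d)"
      by (rule sum.reindex_bij_witness[of _ "\<lambda>d. d + k" "\<lambda>m. m - k"]) auto
    also have "\<dots> \<le> ?T" using t by (intro sum_mono2) auto
    finally show ?thesis .
  qed
  have col: "(\<Sum>k | k \<le> n \<and> k < m. t (m - k)) \<le> ?T" if "m \<le> n" for m
  proof -
    have "(\<Sum>k | k \<le> n \<and> k < m. t (m - k)) = (\<Sum>d\<in>{0<..m}. t d)"
      using that by (intro sum.reindex_bij_witness[of _ "\<lambda>d. m - d" "\<lambda>k. m - k"]) auto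
    also have "\<dots> \<le> ?T" using t that by (intro sum_mono2) auto
    finally show ?thesis .
  qed
  have "(\<Sum>m\<in>{k<..n}. A k m * a m)\<^sup>2 \<le> ?T * (\<Sum>m\<in>{k<..n}. t (m - k) * (a m)\<^sup>2)" for k
  proof -
    have "\<bar>\<Sum>m\<in>{k<..n}. A k m * a m\<bar> \<le> (\<Sum>m\<in>{k<..n}. t (m - k) * \<bar>a m\<bar>)"
      using A by (intro order.trans[OF sum_abs] sum_mono) (auto simp: abs_mult intro!: mult_right_mono)
    also have "\<dots> = (\<Sum>m\<in>{k<..n}. sqrt (t (m - k)) * (sqrt (t (m - k)) * \<bar>a m\<bar>))"
      using t by (simp flip: mult.assoc)
    finally have "\<bar>\<Sum>m\<in>{k<..n}. A k m * a m\<bar>\<^sup>2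
        \<le> (\<Sum>m\<in>{k<..n}. sqrt (t (m - k)) * (sqrt (t (m - k)) * \<bar>a m\<bar>))\<^sup>2"
      by (intro power_mono) auto
    also have "\<dots> \<le> (\<Sum>m\<in>{k<..n}. (sqrt (t (m - k)))\<^sup>2) * (\<Sum>m\<in>{k<..n}. (sqrt (t (m - k)) * \<bar>a m\<bar>)\<^sup>2)"
      by (rule Cauchy_Schwarz_ineq_sum)
    also have "\<dots> = (\<Sum>m\<in>{k<..n}. t (m - k)) * (\<Sum>m\<in>{k<..n}. t (m - k) * (a m)\<^sup>2)"
      using t by (simp add: power_mult_distrib)
    also have "\<dots> \<le> ?T * (\<Sum>m\<in>{k<..n}. t (m - k) * (a m)\<^sup>2)"
      using t by (intro mult_right_mono row sum_nonneg) auto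
    finally show ?thesis by simp
  qed
  hence "(\<Sum>k\<le>n. (\<Sum>m\<in>{k<..n}. A k m * a m)\<^sup>2) \<le> (\<Sum>k\<le>n. ?T * (\<Sum>m\<in>{k<..n}. t (m - k) * (a m)\<^sup>2))"
    by (intro sum_mono)
  also have "\<dots> = ?T * (\<Sum>k\<le>n. \<Sum>m | m \<le> n \<and> k < m. t (m - k) * (a m)\<^sup>2)"
    unfolding sum_distrib_left by (intro sum.cong) auto
  also have "(\<Sum>k\<le>n. \<Sum>m | m \<le> n \<and> k < m. t (m - k) * (a m)\<^sup>2)
      = (\<Sum>m\<le>n. (\<Sum>k | k \<le> n \<and> k < m. t (m - k)) * (a m)\<^sup>2)"
    using sum.swap_restrict[of "{..n}" "{..n}" "\<lambda>k m. t (m - k) * (a m)\<^sup>2" "\<lambda>k m. k < m"]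
    by (simp add: sum_distrib_right)
  also have "?T * \<dots> \<le> ?T * (\<Sum>m\<le>n. ?T * (a m)\<^sup>2)"
    using col T by (intro mult_left_mono sum_mono mult_right_mono) auto
  also have "\<dots> = ?T\<^sup>2 * (\<Sum>k\<le>n. (a k)\<^sup>2)"
    by (simp only: sum_distrib_left[symmetric] power2_eq_square[of ?T] mult.assoc)
  finally show ?thesis .
qed

lemma markov_const_le_toeplitz:
  assumes "0 < c" "c < 1" "0 < \<beta>" and t: "\<And>d. t d \<ge> 0"
    and "\<And>k m. k < m \<Longrightarrow> m \<le> n \<Longrightarrow> markov_entry c \<beta> k m \<le> t (m - k)"
  shows "markov_const n c \<beta> \<le> (\<Sum>d\<in>{0<..n}. t d)"
proof (rule markov_const_le[OF assms(1-3)])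
  show "0 \<le> (\<Sum>d\<in>{0<..n}. t d)" using t by (intro sum_nonneg)
  show "markov_form c \<beta> n a \<le> (\<Sum>d\<in>{0<..n}. t d)\<^sup>2 * (\<Sum>k\<le>n. (a k)\<^sup>2)" for a
    unfolding markov_form_def using assms(5) markov_entry_pos[OF assms(1-3)]
    by (intro toeplitz_schur_test t) (simp add: less_imp_le)
qed

section \<open>The case \<beta> = 1\<close>

lemma geometric_partial_sum:
  fixes r :: real assumes "r \<noteq> 1"
  shows "(\<Sum>d\<in>{0<..n}. r ^ d) = r * (1 - r ^ n) / (1 - r)"
proof (induction n)
  case (Suc n)
  have "{0<..Suc n} = insert (Suc n) {0<..n}" by auto
  moreover have "r ^ Suc n + r * (1 - r ^ n) / (1 - r) = r * (1 - r ^ Suc n) / (1 - r)"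
    using assms by (simp add: field_simps)
  ultimately show ?case using Suc by simp
qed simp

lemma markov_entry_one:
  assumes "0 < c" "k \<le> m"
  shows "markov_entry c 1 k m = (1 - c) / c * sqrt c ^ (m - k)"
proof -
  have "(\<Prod>j\<in>{k..<m}. (real j + 1) / (real j + 1)) = 1" by (intro prod.neutral) auto
  thus ?thesis using markov_entry_eq[OF assms(1) zero_less_one assms(2)] by (simp add: real_sqrt_power)
qed

text \<open>With s = sqrt c, the factor 1 - s of 1 - c cancels the denominator of the geometric
  sum.\<close>

lemma markov_row_sum_one:
  assumes "0 < c" "c < 1"
  shows "(\<Sum>d\<in>{0<..n}. (1 - c) / c * sqrt c ^ d) = (1 + 1 / sqrt c) * (1 - sqrt c ^ n)"
proof -
  have s: "sqrt c > 0" "sqrt c < 1" using assms by auto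
  have "1 - c = (1 - sqrt c) * (1 + sqrt c)" "c = sqrt c * sqrt c"
    using assms by (simp_all add: algebra_simps)
  hence "(1 - c) / c = (1 - sqrt c) * (1 + sqrt c) / (sqrt c * sqrt c)" by (rule arg_cong2)
  hence "(1 - c) / c * (sqrt c * (1 - sqrt c ^ n) / (1 - sqrt c))
      = (1 - sqrt c) / (1 - sqrt c) * ((1 + sqrt c) / sqrt c * (1 - sqrt c ^ n))"
    using s by (simp only:) (simp del: real_sqrt_mult_self)
  also have "\<dots> = (1 + 1 / sqrt c) * (1 - sqrt c ^ n)"
    using s by (simp add: add_divide_distrib)
  finally have "(1 - c) / c * (sqrt c * (1 - sqrt c ^ n) / (1 - sqrt c)) = (1 + 1 / sqrt c) * (1 - sqrt c ^ n)" .
  thus ?thesis using geometric_partial_sum[of "sqrt c" n] s by (simp only: sum_distrib_left[symmetric])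
qed

lemma markov_const_one_less:
  assumes "0 < c" "c < 1"
  shows "markov_const n c 1 < 1 + 1 / sqrt c"
proof -
  have "markov_const n c 1 \<le> (\<Sum>d\<in>{0<..n}. (1 - c) / c * sqrt c ^ d)"
    using assms by (intro markov_const_le_toeplitz) (simp_all add: markov_entry_one)
  \<comment> \<open>The missing tail \<open>sqrt c ^ n\<close> is positive for each finite
    n.\<close>
  also have "\<dots> < (1 + 1 / sqrt c) * 1"
    unfolding markov_row_sum_one[OF assms] using assms by (intro mult_strict_left_mono) (auto intro: add_pos_pos)
  finally show ?thesis by simp
qed

lemma markov_const_one_ge:
  assumes "0 < c" "c < 1"
  shows "(1 + 1 / sqrt c) * (1 - 2 / (1 - sqrt c) * inverse (real (Suc n))) \<le> markov_const n c 1"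
proof -
  let ?L = "1 + 1 / sqrt c" and ?s = "sqrt c" and ?g = "markov_const n c 1"
  have s: "0 < ?s" "?s < 1" using assms by auto
  have L: "?L > 0" using s by (simp add: add_pos_pos)
  have row: "(\<Sum>m\<in>{k<..n}. markov_entry c 1 k m * 1) = ?L * (1 - ?s ^ (n - k))" if "k \<le> n" for k
  proof -
    have "(\<Sum>m\<in>{k<..n}. markov_entry c 1 k m * 1) = (\<Sum>m\<in>{k<..n}. (1 - c) / c * ?s ^ (m - k))"
      using assms by (intro sum.cong refl) (simp add: markov_entry_one)
    also have "\<dots> = (\<Sum>d\<in>{0<..n - k}. (1 - c) / c * ?s ^ d)"
      by (rule sum.reindex_bij_witness[of _ "\<lambda>d. d + k" "\<lambda>m. m - k"]) auto
    finally show ?thesis using markov_row_sum_one[OF assms] by simp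
  qed
  \<comment> \<open>All-ones test vector; \<open>(1 - s\<^sup>i)\<^sup>2 \<ge> 1 - 2 s\<^sup>i\<close> makes the loss a convergent geometric sum.\<close>
  have "(\<Sum>i<Suc n. ?s ^ i) \<le> 1 / (1 - ?s)"
    using s by (subst sum_gp_strict) (auto intro!: divide_right_mono)
  hence "?L\<^sup>2 * (real (Suc n) - 2 / (1 - ?s)) \<le> ?L\<^sup>2 * (real (Suc n) - 2 * (\<Sum>i<Suc n. ?s ^ i))"
    by (intro mult_left_mono) auto
  also have "\<dots> = (\<Sum>i<Suc n. ?L\<^sup>2 * (1 - 2 * ?s ^ i))"
    by (simp only: sum_distrib_left[symmetric] sum_subtractf) simp
  also have "\<dots> \<le> (\<Sum>i<Suc n. (?L * (1 - ?s ^ i))\<^sup>2)"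
    unfolding power_mult_distrib
    by (intro sum_mono mult_left_mono) (simp_all add: power2_diff)
  also have "\<dots> = (\<Sum>k\<le>n. (?L * (1 - ?s ^ (n - k)))\<^sup>2)"
    by (rule sum.reindex_bij_witness[of _ "\<lambda>k. n - k" "\<lambda>i. n - i"]) auto
  also have "\<dots> = markov_form c 1 n (\<lambda>_. 1)"
    unfolding markov_form_def by (intro sum.cong refl) (simp only: row atMost_iff)
  also have "\<dots> \<le> ?g\<^sup>2 * (\<Sum>k\<le>n. 1\<^sup>2)"
    using assms by (intro markov_form_le) auto
  \<comment> \<open>One factor \<open>?g\<close> is replaced by its upper bound \<open>?L\<close>. A
    factor \<open>?L\<close> then cancels, leaving an estimate linear in \<open>?g\<close>.\<close>
  also have "\<dots> \<le> (?L * ?g) * (\<Sum>k\<le>n. 1\<^sup>2)"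
    unfolding power2_eq_square[of ?g] using markov_const_one_less[OF assms, of n] markov_const_nonneg[OF assms, of 1 n]
    by (intro mult_right_mono) auto
  finally have "?L * (?L * (real (Suc n) - 2 / (1 - ?s))) \<le> ?L * (?g * real (Suc n))"
    by (simp add: power2_eq_square mult_ac)
  hence "?L * (real (Suc n) - 2 / (1 - ?s)) \<le> ?g * real (Suc n)" using L by (simp only: mult_le_cancel_left_pos)
  hence "?L * (real (Suc n) - 2 / (1 - ?s)) / real (Suc n) \<le> ?g" by (simp only: pos_divide_le_eq of_nat_0_less_iff zero_less_Suc)
  moreover have "?L * (real (Suc n) - 2 / (1 - ?s)) / real (Suc n) = ?L * (1 - 2 / (1 - ?s) * inverse (real (Suc n)))"
    by (simp only: times_divide_eq_right[symmetric] diff_divide_distrib) (simp add: divide_inverse)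
  ultimately show ?thesis by simp
qed

lemma markov_const_one_tendsto:
  assumes "0 < c" "c < 1"
  shows "(\<lambda>n. markov_const n c 1) \<longlonglongrightarrow> 1 + 1 / sqrt c"
proof (rule real_tendsto_sandwich)
  show "(\<lambda>n. (1 + 1 / sqrt c) * (1 - 2 / (1 - sqrt c) * inverse (real (Suc n)))) \<longlonglongrightarrow> 1 + 1 / sqrt c"
  proof -
    have "(\<lambda>n. (1 + 1 / sqrt c) * (1 - 2 / (1 - sqrt c) * inverse (real (Suc n))))
        \<longlonglongrightarrow> (1 + 1 / sqrt c) * (1 - 2 / (1 - sqrt c) * 0)"
      by (intro tendsto_mult tendsto_diff tendsto_const LIMSEQ_inverse_real_of_nat)
    thus ?thesis by simp
  qed
  show "(\<lambda>_. 1 + 1 / sqrt c) \<longlonglongrightarrow> 1 + 1 / sqrt c" by simp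
qed (intro always_eventually allI markov_const_one_ge[OF assms] less_imp_le[OF markov_const_one_less[OF assms]])+

text \<open>The factors (j + 1) / (j + \<beta>) tend to 1, so all but finitely many lie below 1 /
  sqrt c and use up at most half of the geometric decay; the exceptions cost a bounded
  factor.\<close>

lemma markov_const_bounded:
  assumes "0 < c" "c < 1" "0 < \<beta>"
  shows "\<exists>C>0. \<forall>n. markov_const n c \<beta> \<le> C"
proof -
  let ?s = "sqrt c"
  have s: "0 < ?s" "?s < 1" using assms by auto
  have "(\<lambda>j. inverse (1 + (\<beta> - 1) * inverse (real (Suc j)))) \<longlonglongrightarrow> inverse (1 + (\<beta> - 1) * 0)"
    by (intro tendsto_intros LIMSEQ_inverse_real_of_nat) simp
  moreover have "inverse (1 + (\<beta> - 1) * inverse (real (Suc j))) = (real j + 1) / (real j + \<beta>)" for j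
    using assms(3) by (simp add: field_simps)
  ultimately have "(\<lambda>j. (real j + 1) / (real j + \<beta>)) \<longlonglongrightarrow> 1" by simp
  moreover have "1 < 1 / ?s" using s by simp
  ultimately have "\<forall>\<^sub>F j in sequentially. (real j + 1) / (real j + \<beta>) < 1 / ?s" by (rule order_tendstoD(2))
  then obtain J where J: "\<And>j. j \<ge> J \<Longrightarrow> (real j + 1) / (real j + \<beta>) < 1 / ?s"
    by (auto simp: eventually_sequentially)
  \<comment> \<open>This bounds every factor, as j / (j + \<beta>) <= 1 and 1 / (j + \<beta>) <= 1 /
    \<beta>.\<close>
  define M where "M = 1 + 1 / \<beta>"
  have M: "M \<ge> 1" using assms by (simp add: M_def)
  \<comment> \<open>Keeping 1 / \<open>?s\<close> > 1 also for j < J makes the product split into a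
    full power and a power of \<open>M\<close>.\<close>
  have factor: "(real j + 1) / (real j + \<beta>) \<le> 1 / ?s * (if j < J then M else 1)" for j
  proof (cases "j < J")
    case True
    have "(real j + 1) / (real j + \<beta>) \<le> M"
      using assms(3) unfolding M_def by (simp add: field_simps)
    also have "M \<le> 1 / ?s * M" using s M mult_right_mono[of 1 "1 / ?s" M] by simp
    finally show ?thesis using True by simp
  qed (use J[of j] in simp)
  \<comment> \<open>The fourth root of c: the decay left under the root is
    \<open>?s ^ (m - k)\<close>, and the entry takes its square root.\<close>
  define r where "r = sqrt ?s"
  have r: "0 < r" "r < 1" using s by (auto simp: r_def)
  have entry: "markov_entry c \<beta> k m \<le> (1 - c) / c * sqrt (M ^ J) * r ^ (m - k)" if "k < m" for k m
  proof -
    have "(\<Prod>j\<in>{k..<m}. (real j + 1) / (real j + \<beta>)) \<le> (\<Prod>j\<in>{k..<m}. 1 / ?s * (if j < J then M else 1))"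
      using assms(3) by (intro prod_mono conjI factor) auto
    also have "\<dots> = (1 / ?s) ^ (m - k) * M ^ card ({k..<m} \<inter> {j. j < J})"
      unfolding prod.distrib by (simp add: prod.If_cases)
    \<comment> \<open>At most J indices are exceptional, wherever k and m lie.\<close>
    also have "\<dots> \<le> (1 / ?s) ^ (m - k) * M ^ J"
    proof (intro mult_left_mono power_increasing M)
      have "card ({k..<m} \<inter> {j. j < J}) \<le> card {..<J}" by (intro card_mono) auto
      thus "card ({k..<m} \<inter> {j. j < J}) \<le> J" by simp
    qed (use s in simp)
    finally have "c ^ (m - k) * (\<Prod>j\<in>{k..<m}. (real j + 1) / (real j + \<beta>))
        \<le> c ^ (m - k) * ((1 / ?s) ^ (m - k) * M ^ J)"
      using assms(1) by (intro mult_left_mono) auto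
    also have "\<dots> = (c * (1 / ?s)) ^ (m - k) * M ^ J" by (simp only: power_mult_distrib mult.assoc)
    also have "c * (1 / ?s) = ?s" using assms(1) by (simp add: real_div_sqrt)
    finally have *: "c ^ (m - k) * (\<Prod>j\<in>{k..<m}. (real j + 1) / (real j + \<beta>)) \<le> ?s ^ (m - k) * M ^ J" .
    have **: "sqrt (c ^ (m - k) * (\<Prod>j\<in>{k..<m}. (real j + 1) / (real j + \<beta>))) \<le> sqrt (M ^ J) * r ^ (m - k)"
      using real_sqrt_le_mono[OF *] by (simp only: real_sqrt_mult real_sqrt_power r_def mult.commute)
    have "(1 - c) / c * sqrt (c ^ (m - k) * (\<Prod>j\<in>{k..<m}. (real j + 1) / (real j + \<beta>)))
        \<le> (1 - c) / c * (sqrt (M ^ J) * r ^ (m - k))"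
      by (rule mult_left_mono[OF **]) (use assms in simp)
    thus ?thesis using markov_entry_eq[OF assms(1,3), of k m] that by (simp only: less_imp_le mult.assoc)
  qed
  define K where "K = (1 - c) / c * sqrt (M ^ J)"
  have K: "K > 0" using assms M by (simp add: K_def)
  have "markov_const n c \<beta> \<le> K / (1 - r)" for n
  proof -
    have "markov_const n c \<beta> \<le> (\<Sum>d\<in>{0<..n}. K * r ^ d)"
      using entry K r by (intro markov_const_le_toeplitz[OF assms]) (simp, simp only: K_def)
    also have "\<dots> = K * (r * (1 - r ^ n) / (1 - r))"
      using geometric_partial_sum[of r n] r by (simp flip: sum_distrib_left)
    also have "\<dots> \<le> K * (1 / (1 - r))"
    proof (intro mult_left_mono divide_right_mono)
      show "r * (1 - r ^ n) \<le> 1" using r by (intro mult_le_one) (auto simp: power_le_one)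
    qed (use r K in auto)
    finally show ?thesis by simp
  qed
  moreover have "K / (1 - r) > 0" using K r by simp
  ultimately show ?thesis by blast
qed

theorem theorem1p1:
  shows "(\<forall>c::real. 0 < c \<and> c < 1 \<longrightarrow>
            (\<forall>n::nat. n \<ge> 1 \<longrightarrow> markov_const n c 1 < 1 + 1 / sqrt c) \<and>
            (\<lambda>n. markov_const n c 1) \<longlonglongrightarrow> 1 + 1 / sqrt c) \<and>
         (\<forall>(n::nat) c::real. n \<ge> 1 \<and> 0 < c \<and> c < 1 \<longrightarrow>
            strict_antimono_on {0<..} (\<lambda>\<beta>::real. markov_const n c \<beta>)) \<and>
         (\<forall>(c::real) \<beta>::real. 0 < c \<and> c < 1 \<and> 0 < \<beta> \<longrightarrow>
            (\<exists>C::real. C > 0 \<and> (\<forall>n::nat. n \<ge> 1 \<longrightarrow> markov_const n c \<beta> \<le> C)))"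
proof (intro conjI allI impI; (elim conjE)?)
  fix c :: real and n :: nat assume "0 < c" "c < 1"
  thus "markov_const n c 1 < 1 + 1 / sqrt c" by (rule markov_const_one_less)
next
  fix c :: real assume "0 < c" "c < 1"
  thus "(\<lambda>n. markov_const n c 1) \<longlonglongrightarrow> 1 + 1 / sqrt c" by (rule markov_const_one_tendsto)
next
  fix n :: nat and c :: real assume "n \<ge> 1" "0 < c" "c < 1"
  thus "strict_antimono_on {0<..} (\<lambda>\<beta>::real. markov_const n c \<beta>)"
    by (intro monotone_onI) (auto intro: markov_const_strict_antimono)
next
  fix c \<beta> :: real assume "0 < c" "c < 1" "0 < \<beta>"
  from markov_const_bounded[OF this]
  show "\<exists>C::real. C > 0 \<and> (\<forall>n::nat. n \<ge> 1 \<longrightarrow> markov_const n c \<beta> \<le> C)" by blast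
qed

end
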